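(* Consider the system described in the context with infinite battery capacity, mean harvested energy per slot $\bar A$, $p_c\in(0,1]$, $v>0$, and $E_u:[0,R]\to[0,\infty)$ continuous and increasing. Let $$\bar E_u=\int_0^R E_u(d)\tfrac{2d}{R^2}\,\mathrm{d}d,\qquad C=C_{\mathrm{thr,EE}}=\min\Big\{N,\Big\lfloor\Big(\frac{Np_u\bar E_u}{p_cE_p\sum_{j=1}^N j^{-v}}\Big)^{1/v}\Big\rfloor\Big\},$$ $$\eta=\Big(1-\frac{p_cC}{N+p_c}\Big)p_u\Big(1-\sum_{i=1}^{C}f_i\Big).$$ Let $\tilde d\in[0,R]$ be the largest value with $$\int_0^{\tilde d}E_u(d)\tfrac{2d}{R^2}\,\mathrm{d}d\le\min\Big\{\bar E_u,\ \tfrac1\eta\max\Big\{0,\bar A-\tfrac{p_cCE_p}{N+p_c}\Big\}\Big\}.$$ Under the energy-efficient threshold-based (EETB) policy, the SBS acts as follows in slot $k$: - if $C_k<C$: it pushes when $E_k\ge E_p$, and sleeps otherwise; - if $C_k\ge C$: it unicasts the requested content when there is a request (necessarily for a content of rank $>C_k$) with unicast energy $Q_k$ satisfying $0<Q_k\le\min\{E_u(\tilde d),E_k\}$, and sleeps otherwise. If $\bar A\ge \frac{p_cCE_p}{N+p_c}$, the blocking probability of the EETB policy is $$p_{\mathrm{blk,EE}}=\frac{p_cp_uC}{N+p_c}\Big(1-\sum_{i=1}^{C}f_i\Big)+\eta\,\frac{R^2-\tilde d^2}{R^2}.$$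
   Context: Time is slotted. There are $N$ contents ranked $c_1,\dots,c_N$, and rank $i$ has popularity $f_i=\frac{i^{-v}}{\sum_{j=1}^N j^{-v}}$. Popularity dynamics: in each slot, with probability $p_c$, a uniformly chosen content is removed; the contents below it move up one rank, and a new content enters at rank $N$. Push state and actions: users store $c_1,\dots,c_{C_k}$ ($C_k\in\{0,\dots,N\}$). In each slot the SBS chooses sleep (cost $0$), unicast to the current requester at distance $d$ (cost $E_u(d)$), or push (cost $E_p$, sends $c_{C_k+1}$ to all users). The energy used must not exceed the battery level $E_k$. Transitions of $C_k$: - without push: $C_{k+1}=C_k-1$ with probability $p_cC_k/N$, else $C_k$; - with push: $C_{k+1}=C_k$ with probability $p_cC_k/N$, else $C_k+1$. Requests: each slot, independently, with probability $p_u$ there is a request, for $c_i$ with probability $f_i$, from a location uniform in the disk of radius $R$ around the SBS. The quantity $Q_k=E_u(d)$ denotes the unicast energy of the current request ($Q_k=0$ if there is no request). A request is blocked if its content has rank $>C_k$ and it is neither unicast nor pushed in that slot. The blocking probability is the long-run fraction of slots with a blocked request. Energy: the battery evolves as $E_{k+1}=E_k-U_k+A_k$ (infinite capacity), where $U_k$ is the energy used in slot $k$ and the harvested energies $A_k$ are i.i.d. with mean $\bar A$. *)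

theory Defs
  imports "HOL-Probability.Probability"
begin

definition zipf_pop :: "nat \<Rightarrow> real \<Rightarrow> nat \<Rightarrow> real" where
  "zipf_pop N v i = real i powr (- v) / (\<Sum>j=1..N. real j powr (- v))"

definition part_unicast :: "real \<Rightarrow> (real \<Rightarrow> real) \<Rightarrow> real \<Rightarrow> real" where
  "part_unicast R Eu t = integral {0..t} (\<lambda>d. Eu d * (2 * d / R\<^sup>2))"

definition Ebar_u :: "real \<Rightarrow> (real \<Rightarrow> real) \<Rightarrow> real" where
  "Ebar_u R Eu = part_unicast R Eu R"

definition C_thr_EE :: "nat \<Rightarrow> real \<Rightarrow> real \<Rightarrow> real \<Rightarrow> real \<Rightarrow> real \<Rightarrow> (real \<Rightarrow> real) \<Rightarrow> nat" where
  "C_thr_EE N v pc pu Ep R Eu =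
     min N (nat \<lfloor>((real N * pu * Ebar_u R Eu) / (pc * Ep * (\<Sum>j=1..N. real j powr (- v)))) powr (1 / v)\<rfloor>)"

definition eta_EE :: "nat \<Rightarrow> real \<Rightarrow> real \<Rightarrow> real \<Rightarrow> nat \<Rightarrow> real" where
  "eta_EE N v pc pu C = (1 - pc * real C / (real N + pc)) * pu * (1 - (\<Sum>i=1..C. zipf_pop N v i))"

text \<open>Per-slot random input:
  (removal happens, removed rank, request happens, requested rank, requester location, harvested energy).\<close>
type_synonym slot_input = "bool \<times> nat \<times> bool \<times> nat \<times> complex \<times> real"

text \<open>Distribution of one slot input: all components independent.
  F is the request-rank distribution, alpha the harvested-energy distribution.\<close>
definition slot_dist :: "nat \<Rightarrow> real \<Rightarrow> real \<Rightarrow> nat pmf \<Rightarrow> real \<Rightarrow> real measure \<Rightarrow> slot_input measure" where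
  "slot_dist N pc pu F R alpha =
     measure_pmf (bernoulli_pmf pc) \<Otimes>\<^sub>M measure_pmf (pmf_of_set {1..N}) \<Otimes>\<^sub>M
     measure_pmf (bernoulli_pmf pu) \<Otimes>\<^sub>M measure_pmf F \<Otimes>\<^sub>M
     uniform_measure lborel (cball (0::complex) R) \<Otimes>\<^sub>M alpha"

text \<open>State = (C_k, E_k).  Policy decisions of EETB.\<close>
definition eetb_push :: "nat \<Rightarrow> real \<Rightarrow> nat \<times> real \<Rightarrow> bool" where
  "eetb_push C Ep s = (fst s < C \<and> Ep \<le> snd s)"

definition eetb_unicast :: "nat \<Rightarrow> (real \<Rightarrow> real) \<Rightarrow> real \<Rightarrow> nat \<times> real \<Rightarrow> slot_input \<Rightarrow> bool" where
  "eetb_unicast C Eu dt s x = (case x of (rm, r, rq, i, z, a) \<Rightarrow>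
      C \<le> fst s \<and> rq \<and> fst s < i \<and> 0 < Eu (cmod z) \<and> Eu (cmod z) \<le> min (Eu dt) (snd s))"

definition eetb_step :: "nat \<Rightarrow> real \<Rightarrow> (real \<Rightarrow> real) \<Rightarrow> real \<Rightarrow> nat \<times> real \<Rightarrow> slot_input \<Rightarrow> nat \<times> real" where
  "eetb_step C Ep Eu dt s x = (case x of (rm, r, rq, i, z, a) \<Rightarrow>
     let c = fst s; e = snd s; dec = (rm \<and> r \<le> c) in
     if eetb_push C Ep s then ((if dec then c else c + 1), e - Ep + a)
     else if eetb_unicast C Eu dt s x then ((if dec then c - 1 else c), e - Eu (cmod z) + a)
     else ((if dec then c - 1 else c), e + a))"

primrec eetb_state :: "nat \<Rightarrow> real \<Rightarrow> (real \<Rightarrow> real) \<Rightarrow> real \<Rightarrow> nat \<times> real \<Rightarrow> (nat \<Rightarrow> slot_input) \<Rightarrow> nat \<Rightarrow> nat \<times> real" where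
  "eetb_state C Ep Eu dt s0 xs 0 = s0"
| "eetb_state C Ep Eu dt s0 xs (Suc k) = eetb_step C Ep Eu dt (eetb_state C Ep Eu dt s0 xs k) (xs k)"

definition eetb_blocked :: "nat \<Rightarrow> real \<Rightarrow> (real \<Rightarrow> real) \<Rightarrow> real \<Rightarrow> nat \<times> real \<Rightarrow> (nat \<Rightarrow> slot_input) \<Rightarrow> nat \<Rightarrow> bool" where
  "eetb_blocked C Ep Eu dt s0 xs k = (let s = eetb_state C Ep Eu dt s0 xs k; x = xs k in
     case x of (rm, r, rq, i, z, a) \<Rightarrow>
       rq \<and> fst s < i \<and> \<not> eetb_unicast C Eu dt s x \<and> \<not> (eetb_push C Ep s \<and> i = fst s + 1))"

end

theory Submission
  imports Defs "HOL-Library.Discrete_Functions"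
begin

text \<open>
  The argument is pathwise: all random inputs enter through almost sure laws of large numbers for
  terms \<open>H (state k) * (g (input k) - E g)\<close>, which are bounded and pairwise orthogonal.

  With enough energy the number of stored contents settles on \<open>C - 1\<close> and \<open>C\<close>, and the balance
  equation between the two gives frequency \<open>\<phi> = pc * C / (N + pc)\<close> for \<open>C - 1\<close> (push slots) and
  \<open>1 - \<phi>\<close> for \<open>C\<close>. It remains to see that energy shortages have frequency zero, also in the critical
  case where the mean consumption equals the mean harvest. Balancing pushes against removals shows
  that shortages only lower the long-run consumption, by at least a fixed multiple of the energy
  they withhold. So accumulated shortages of linear order would make the battery level grow
  linearly; but shortages occur only at bounded battery level, and looking at the last shortage
  gives a contradiction.
\<close>

section \<open>Cesaro-null sequences\<close>

text \<open>The critical case cannot be avoided. \<open>part_unicast\<close> is continuous in the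
  distance, so the maximal \<open>dt\<close> uses the energy budget up exactly whenever the harvest
  bound is the active one and \<open>\<eta>\<close> is positive. The battery then has no mean drift
  and the pair of cache and battery level need not have a stationary law, so every frequency is
  derived from averages along one path. The obstacle is that a shortage of one kind could shift time
  into states that consume more of the other kind. Two balances exclude this. In the long run pushes
  match removals of stored contents, which occur at rate \<open>t = pc / N\<close> per stored
  content; a starved slot lies below \<open>C\<close>, so at least one content is absent and pushes
  drop. Solving for the push frequency, which itself enters the time spent below \<open>C\<close>,
  turns the saving \<open>t\<close> into \<open>t / (1 + t)\<close>. The flow across level
  \<open>C\<close> bounds the time at \<open>C\<close>, the only non-negligible level with unicasts,
  by \<open>1 - \<phi>\<close> on average. Consumption therefore stays below the budget by the
  energy recorded in \<open>loss\<close>.\<close>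

definition cesaro_null :: "(nat \<Rightarrow> real) \<Rightarrow> bool" where
  "cesaro_null X \<longleftrightarrow> (\<lambda>n. (\<Sum>k<n. X k) / real n) \<longlonglongrightarrow> 0"

lemma cesaro_null_add:
  "cesaro_null X \<Longrightarrow> cesaro_null Y \<Longrightarrow> cesaro_null (\<lambda>k. X k + Y k)"
  unfolding cesaro_null_def
  by (drule (1) tendsto_add) (simp add: sum.distrib add_divide_distrib)

lemma cesaro_null_mult_left: "cesaro_null X \<Longrightarrow> cesaro_null (\<lambda>k. a * X k)"
  unfolding cesaro_null_def
  by (drule tendsto_mult_left[where c = a]) (simp add: sum_distrib_left[symmetric])

lemma cesaro_null_minus: "cesaro_null X \<Longrightarrow> cesaro_null (\<lambda>k. - X k)"
  using cesaro_null_mult_left[of X "-1"] by simp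

lemma cesaro_null_diff:
  "cesaro_null X \<Longrightarrow> cesaro_null Y \<Longrightarrow> cesaro_null (\<lambda>k. X k - Y k)"
  using cesaro_null_add[of X "\<lambda>k. - Y k"] cesaro_null_minus[of Y] by simp

lemma cesaro_null_zero: "cesaro_null (\<lambda>k. 0)"
  by (simp add: cesaro_null_def)

lemma cesaro_null_sum:
  "(\<And>i. i \<in> I \<Longrightarrow> cesaro_null (X i)) \<Longrightarrow> cesaro_null (\<lambda>k. \<Sum>i\<in>I. X i k)"
  by (induction I rule: infinite_finite_induct) (auto intro: cesaro_null_zero cesaro_null_add)

lemma cesaro_null_abs_le:
  assumes "\<And>k. \<bar>X k\<bar> \<le> Y k" and "cesaro_null Y"
  shows "cesaro_null X"
  unfolding cesaro_null_def
proof (rule tendsto_rabs_zero_cancel, rule tendsto_sandwich[OF _ _ tendsto_const assms(2)[unfolded cesaro_null_def]])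
  have "\<bar>\<Sum>k<n. X k\<bar> \<le> (\<Sum>k<n. Y k)" for n
    using sum_abs[of X "{..<n}"] sum_mono[of "{..<n}" "\<lambda>k. \<bar>X k\<bar>" Y] assms(1) by (meson order_trans)
  then show "\<forall>\<^sub>F n in sequentially. \<bar>(\<Sum>k<n. X k) / real n\<bar> \<le> (\<Sum>k<n. Y k) / real n"
    by (auto simp: abs_divide intro!: divide_right_mono always_eventually)
qed auto

text \<open>Source of every balance equation below: the increments of a bounded function of the
  state have bounded partial sums, so inflow and outflow agree on average.\<close>

lemma cesaro_null_telescope:
  assumes "\<And>k. \<bar>f k\<bar> \<le> (b :: real)"
  shows "cesaro_null (\<lambda>k. f (Suc k) - f k)"
  unfolding cesaro_null_def sum_lessThan_telescope
proof (rule tendsto_rabs_zero_cancel, rule tendsto_sandwich[OF _ _ tendsto_const])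
  have "\<bar>f n - f 0\<bar> \<le> 2 * b" for n
    using assms[of n] assms[of 0] by linarith
  then show "\<forall>\<^sub>F n in sequentially. \<bar>(f n - f 0) / real n\<bar> \<le> 2 * b / real n"
    by (auto simp: abs_divide intro!: divide_right_mono always_eventually)
  show "(\<lambda>n. 2 * b / real n) \<longlonglongrightarrow> 0"
    by (rule lim_const_over_n)
qed auto

lemma cesaro_null_leI:
  assumes nonneg: "\<And>k. 0 \<le> X k"
    and bound: "\<And>\<epsilon>. 0 < \<epsilon> \<Longrightarrow> \<exists>a. \<forall>n. (\<Sum>k<n. X k) \<le> a + \<epsilon> * real n"
  shows "cesaro_null X"
  unfolding cesaro_null_def
proof (rule tendstoI)
  fix \<epsilon> :: real assume "0 < \<epsilon>"
  then obtain a where a: "(\<Sum>k<n. X k) \<le> a + \<epsilon> / 2 * real n" for n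
    using bound[of "\<epsilon> / 2"] by auto
  have "(\<lambda>n. a / real n) \<longlonglongrightarrow> 0"
    by (rule lim_const_over_n)
  then have "\<forall>\<^sub>F n in sequentially. a / real n < \<epsilon> / 2"
    using \<open>0 < \<epsilon>\<close> by (intro order_tendstoD) auto
  then show "\<forall>\<^sub>F n in sequentially. dist ((\<Sum>k<n. X k) / real n) 0 < \<epsilon>"
    using eventually_gt_at_top[of 0]
  proof eventually_elim
    case (elim n)
    have "(\<Sum>k<n. X k) / real n \<le> (a + \<epsilon> / 2 * real n) / real n"
      using a by (intro divide_right_mono) auto
    also have "\<dots> = a / real n + \<epsilon> / 2"
      using elim by (simp add: add_divide_distrib)
    also have "\<dots> < \<epsilon>"
      using elim by linarith
    finally show ?case
      using nonneg by (simp add: sum_nonneg)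
  qed
qed

lemma cesaro_nullD:
  assumes "cesaro_null X" and "0 < \<epsilon>"
  obtains m where "\<And>n. m \<le> n \<Longrightarrow> \<bar>\<Sum>k<n. X k\<bar> \<le> \<epsilon> * real n"
proof -
  have "\<forall>\<^sub>F n in sequentially. dist ((\<Sum>k<n. X k) / real n) 0 < \<epsilon>"
    using assms unfolding cesaro_null_def by (rule tendstoD)
  then obtain m where m: "dist ((\<Sum>k<n. X k) / real n) 0 < \<epsilon>" if "m \<le> n" for n
    by (auto simp: eventually_sequentially)
  show thesis
  proof (rule that[of m])
    fix n assume "m \<le> n"
    then show "\<bar>\<Sum>k<n. X k\<bar> \<le> \<epsilon> * real n"
      using m[of n] by (cases "n = 0") (auto simp: abs_divide field_simps)
  qed
qed

text \<open>The null majorant may depend on the tolerance. This serves the count of missed unicasts,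
  where small distances are cut off at a radius chosen from the tolerance.\<close>

lemma cesaro_null_approxI:
  assumes nonneg: "\<And>k. 0 \<le> X k"
    and approx: "\<And>\<epsilon>. 0 < \<epsilon> \<Longrightarrow> \<exists>Y. cesaro_null Y \<and> (\<forall>k. X k \<le> Y k + \<epsilon>)"
  shows "cesaro_null X"
proof (rule cesaro_null_leI[OF nonneg])
  fix \<epsilon> :: real assume \<epsilon>: "0 < \<epsilon>"
  then obtain Y where Y: "cesaro_null Y" "\<And>k. X k \<le> Y k + \<epsilon> / 2"
    using approx[of "\<epsilon> / 2"] by auto
  obtain m where m: "\<And>n. m \<le> n \<Longrightarrow> \<bar>\<Sum>k<n. Y k\<bar> \<le> \<epsilon> / 2 * real n"
    using cesaro_nullD[OF Y(1), of "\<epsilon> / 2"] \<epsilon> by auto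
  have "(\<Sum>k<n. X k) \<le> (\<Sum>k<m. X k) + \<epsilon> * real n" for n
  proof (cases "m \<le> n")
    case True
    have "(\<Sum>k<n. X k) \<le> (\<Sum>k<n. Y k + \<epsilon> / 2)"
      by (intro sum_mono Y(2))
    also have "\<dots> \<le> \<epsilon> * real n"
      using m[OF True] abs_ge_self[of "\<Sum>k<n. Y k"] by (simp add: sum.distrib mult.commute)
    finally show ?thesis using sum_nonneg[of "{..<m}" X] nonneg by simp
  next
    case False
    then have "(\<Sum>k<n. X k) \<le> (\<Sum>k<m. X k)"
      by (intro sum_mono2) (auto simp: nonneg)
    then show ?thesis using \<epsilon> by (simp add: add_increasing2)
  qed
  then show "\<exists>a. \<forall>n. (\<Sum>k<n. X k) \<le> a + \<epsilon> * real n" by blast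
qed

text \<open>Losses occur only while the level \<open>e\<close> is low, but accumulated losses force \<open>e\<close> up;
  evaluating the second statement at the last loss bounds the accumulated loss.\<close>
lemma cesaro_null_selflimiting:
  fixes X e :: "nat \<Rightarrow> real"
  assumes nonneg: "\<And>k. 0 \<le> X k" and bounded: "\<And>k. X k \<le> b"
    and low: "\<And>k. X k \<noteq> 0 \<Longrightarrow> e k \<le> B"
    and growth: "\<And>\<epsilon>. 0 < \<epsilon> \<Longrightarrow> \<exists>m. \<forall>n\<ge>m. (\<Sum>k<n. X k) \<le> e n + \<epsilon> * real n"
  shows "cesaro_null X"
proof (rule cesaro_null_leI[OF nonneg])
  fix \<epsilon> :: real assume \<epsilon>: "0 < \<epsilon>"
  then obtain m where m: "(\<Sum>k<n. X k) \<le> e n + \<epsilon> * real n" if "m \<le> n" for n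
    using growth by auto
  define a where "a = (\<Sum>k<m. X k) + \<bar>B\<bar> + b"
  have b: "0 \<le> b" using nonneg[of 0] bounded[of 0] by linarith
  have "(\<Sum>k<n. X k) \<le> a + \<epsilon> * real n" for n
  proof (cases "n \<le> m")
    case True
    then have "(\<Sum>k<n. X k) \<le> (\<Sum>k<m. X k)"
      by (intro sum_mono2) (auto simp: nonneg)
    moreover have "0 \<le> \<epsilon> * real n" using \<epsilon> by simp
    ultimately show ?thesis unfolding a_def using b by linarith
  next
    case False
    then have "m \<le> n" by simp
    then show ?thesis
    proof (induction n rule: dec_induct)
      case base
      have "0 \<le> \<epsilon> * real m" using \<epsilon> by simp
      then show ?case unfolding a_def using b by linarith
    next
      case (step n)
      have sm: "0 \<le> (\<Sum>k<m. X k)" by (simp add: sum_nonneg nonneg)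
      show ?case
      proof (cases "X n = 0")
        case True
        then show ?thesis using step.IH \<epsilon> by (simp add: algebra_simps)
      next
        case False
        have "(\<Sum>k<n. X k) \<le> B + \<epsilon> * real n" using m[OF step.hyps(1)] low[OF False] by linarith
        then show ?thesis
          using bounded[of n] sm \<epsilon> unfolding a_def by (simp add: algebra_simps)
      qed
    qed
  qed
  then show "\<exists>a. \<forall>n. (\<Sum>k<n. X k) \<le> a + \<epsilon> * real n" by blast
qed

text \<open>After the largest square up to \<open>n\<close> there remain at most
  \<open>2 * floor_sqrt n\<close> terms, each bounded by \<open>b\<close>; divided by
  \<open>n\<close> they vanish.\<close>

lemma cesaro_null_squares:
  assumes bounded: "\<And>k. \<bar>X k\<bar> \<le> b"
    and squares: "(\<lambda>n. (\<Sum>k<n\<^sup>2. X k) / real (n\<^sup>2)) \<longlonglongrightarrow> 0"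
  shows "cesaro_null X"
proof -
  define q where "q = (\<lambda>n. (\<Sum>k<n\<^sup>2. X k) / real (n\<^sup>2))"
  have sqrt_top: "filterlim floor_sqrt at_top sequentially"
    unfolding filterlim_at_top
  proof
    fix z
    have "z \<le> floor_sqrt n" if "z\<^sup>2 \<le> n" for n
      using that mono_floor_sqrt' [of "z\<^sup>2" n] by simp
    then show "\<forall>\<^sub>F n in sequentially. z \<le> floor_sqrt n"
      by (auto simp: eventually_sequentially)
  qed
  have lim: "(\<lambda>n. \<bar>q (floor_sqrt n)\<bar> + 2 * b / real (floor_sqrt n)) \<longlonglongrightarrow> 0"
  proof -
    have "(\<lambda>n. \<bar>q n\<bar> + 2 * b / real n) \<longlonglongrightarrow> 0"
      using tendsto_add[OF tendsto_rabs_zero[OF squares] lim_const_over_n[of "2 * b"]]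
      by (simp add: q_def)
    then show ?thesis by (rule filterlim_compose[OF _ sqrt_top])
  qed
  show ?thesis unfolding cesaro_null_def
  proof (rule tendsto_rabs_zero_cancel, rule tendsto_sandwich[OF _ _ tendsto_const lim])
    show "\<forall>\<^sub>F n in sequentially. \<bar>(\<Sum>k<n. X k) / real n\<bar> \<le> \<bar>q (floor_sqrt n)\<bar> + 2 * b / real (floor_sqrt n)"
      using eventually_gt_at_top[of 0]
    proof eventually_elim
      case (elim n)
      define s where "s = floor_sqrt n"
      have s: "0 < s" "s\<^sup>2 \<le> n" "n < (Suc s)\<^sup>2"
        using elim Suc_floor_sqrt_power2_gt[of n] by (auto simp: s_def)
      have b: "0 \<le> b" using bounded[of 0] by linarith
      have "(\<Sum>k<n. X k) = (\<Sum>k<s\<^sup>2. X k) + (\<Sum>k\<in>{s\<^sup>2..<n}. X k)"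
        using s by (simp add: lessThan_atLeast0 sum.atLeastLessThan_concat)
      moreover have "\<bar>\<Sum>k\<in>{s\<^sup>2..<n}. X k\<bar> \<le> real (card {s\<^sup>2..<n}) * b"
        using sum_abs[of X "{s\<^sup>2..<n}"] sum_bounded_above[of "{s\<^sup>2..<n}" "\<lambda>k. \<bar>X k\<bar>" b] bounded
        by (meson order_trans)
      moreover have "card {s\<^sup>2..<n} \<le> 2 * s"
        using s by (auto simp: power2_eq_square)
      then have "real (card {s\<^sup>2..<n}) * b \<le> real (2 * s) * b"
        using b by (intro mult_right_mono of_nat_mono)
      ultimately have *: "\<bar>\<Sum>k<n. X k\<bar> \<le> \<bar>\<Sum>k<s\<^sup>2. X k\<bar> + 2 * real s * b" by simp
      have "\<bar>(\<Sum>k<n. X k) / real n\<bar> \<le> (\<bar>\<Sum>k<s\<^sup>2. X k\<bar> + 2 * real s * b) / real n"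
        using * elim by (simp add: abs_divide divide_right_mono)
      also have "\<dots> \<le> (\<bar>\<Sum>k<s\<^sup>2. X k\<bar> + 2 * real s * b) / real (s\<^sup>2)"
        using s b elim by (intro divide_left_mono) (auto intro!: mult_pos_pos simp del: of_nat_power)
      also have "\<dots> = \<bar>q s\<bar> + 2 * b / real s"
        using s by (simp add: q_def abs_divide add_divide_distrib power2_eq_square)
      finally show ?case by (simp add: s_def)
    qed
  qed auto
qed

text \<open>Orthogonality leaves only the diagonal of the squared sum, so the average over
  \<open>n^2\<close> terms has second moment at most \<open>b^2 / n^2\<close>. These moments are
  summable, hence the averages along squares tend to zero almost surely, and boundedness fills the
  gaps between squares.\<close>

lemma (in prob_space) cesaro_null_orthogonal:
  fixes X :: "nat \<Rightarrow> 'a \<Rightarrow> real"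
  assumes rv[measurable]: "\<And>k. X k \<in> borel_measurable M"
    and bounded: "\<And>k \<omega>. \<bar>X k \<omega>\<bar> \<le> b"
    and orth: "\<And>j k. j < k \<Longrightarrow> expectation (\<lambda>\<omega>. X j \<omega> * X k \<omega>) = 0"
  shows "AE \<omega> in M. cesaro_null (\<lambda>k. X k \<omega>)"
proof -
  define T where "T = (\<lambda>n \<omega>. ((\<Sum>k<n\<^sup>2. X k \<omega>) / real (n\<^sup>2))\<^sup>2)"
  have b: "0 \<le> b" using bounded[of 0 undefined] by linarith
  have prod_le: "\<bar>X j \<omega> * X k \<omega>\<bar> \<le> b * b" for j k \<omega>
    unfolding abs_mult by (intro mult_mono bounded b) auto
  have int[simp]: "integrable M (\<lambda>\<omega>. X j \<omega> * X k \<omega>)" for j k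
    by (rule integrable_const_bound[of _ "b * b"]) (use prod_le in auto)
  have orth': "expectation (\<lambda>\<omega>. X j \<omega> * X k \<omega>) = 0" if "j \<noteq> k" for j k
    using orth[of j k] orth[of k j] that by (cases j k rule: linorder_cases) (auto simp: mult.commute)
  have ET: "expectation (\<lambda>\<omega>. (\<Sum>k<n. X k \<omega>)\<^sup>2) \<le> real n * (b * b)" for n
  proof -
    have "expectation (\<lambda>\<omega>. (\<Sum>k<n. X k \<omega>)\<^sup>2) = (\<Sum>j<n. \<Sum>k<n. expectation (\<lambda>\<omega>. X j \<omega> * X k \<omega>))"
      by (simp add: power2_eq_square sum_product)
    also have "\<dots> = (\<Sum>j<n. expectation (\<lambda>\<omega>. X j \<omega> * X j \<omega>))"
    proof (rule sum.cong[OF refl])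
      fix j assume "j \<in> {..<n}"
      have "(\<Sum>k<n. expectation (\<lambda>\<omega>. X j \<omega> * X k \<omega>)) = (\<Sum>k\<in>{j}. expectation (\<lambda>\<omega>. X j \<omega> * X k \<omega>))"
        using \<open>j \<in> {..<n}\<close> by (intro sum.mono_neutral_right) (auto intro: orth')
      then show "(\<Sum>k<n. expectation (\<lambda>\<omega>. X j \<omega> * X k \<omega>)) = expectation (\<lambda>\<omega>. X j \<omega> * X j \<omega>)" by simp
    qed
    also have "\<dots> \<le> (\<Sum>j<n. b * b)"
    proof (rule sum_mono)
      fix j
      have "expectation (\<lambda>\<omega>. X j \<omega> * X j \<omega>) \<le> expectation (\<lambda>\<omega>. b * b)"
        by (rule integral_mono) (auto intro: order_trans[OF abs_ge_self prod_le])
      then show "expectation (\<lambda>\<omega>. X j \<omega> * X j \<omega>) \<le> b * b" by (simp add: prob_space)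
    qed
    finally show ?thesis by simp
  qed
  have ET': "(\<integral>\<^sup>+\<omega>. ennreal (T n \<omega>) \<partial>M) \<le> ennreal (b * b * (1 / real n ^ 2))" for n
  proof -
    have "integrable M (\<lambda>\<omega>. (\<Sum>k<n\<^sup>2. X k \<omega>)\<^sup>2)" by (simp add: power2_eq_square sum_product)
    then have "(\<integral>\<^sup>+\<omega>. ennreal (T n \<omega>) \<partial>M) = ennreal (expectation (\<lambda>\<omega>. (\<Sum>k<n\<^sup>2. X k \<omega>)\<^sup>2) / (real (n\<^sup>2))\<^sup>2)"
      by (subst nn_integral_eq_integral) (auto simp: T_def power_divide)
    also have "\<dots> \<le> ennreal ((real (n\<^sup>2) * (b * b)) / (real (n\<^sup>2))\<^sup>2)"
      by (intro ennreal_leI divide_right_mono ET) auto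
    also have "(real (n\<^sup>2) * (b * b)) / (real (n\<^sup>2))\<^sup>2 = b * b * (1 / real n ^ 2)"
      by (simp add: power2_eq_square)
    finally show ?thesis .
  qed
  have summ: "summable (\<lambda>n. b * b * (1 / real n ^ 2))"
    using inverse_power_summable[of 2, where ?'a = real] by (intro summable_mult) (simp add: inverse_eq_divide)
  have "(\<integral>\<^sup>+\<omega>. (\<Sum>n. ennreal (T n \<omega>)) \<partial>M) = (\<Sum>n. \<integral>\<^sup>+\<omega>. ennreal (T n \<omega>) \<partial>M)"
    by (rule nn_integral_suminf) (simp add: T_def)
  also have "\<dots> \<le> (\<Sum>n. ennreal (b * b * (1 / real n ^ 2)))"
    by (intro suminf_le ET') auto
  also have "\<dots> < \<infinity>"
    by (subst suminf_ennreal2[OF _ summ]) (auto simp: b)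
  finally have "AE \<omega> in M. (\<Sum>n. ennreal (T n \<omega>)) \<noteq> \<infinity>"
    by (intro nn_integral_PInf_AE) (auto simp: T_def)
  then show ?thesis
  proof (rule AE_mp, intro AE_I2 impI)
    fix \<omega> assume "(\<Sum>n. ennreal (T n \<omega>)) \<noteq> \<infinity>"
    then have "summable (\<lambda>n. T n \<omega>)"
      by (intro summable_suminf_not_top) (auto simp: T_def)
    then have "(\<lambda>n. T n \<omega>) \<longlonglongrightarrow> 0" by (rule summable_LIMSEQ_zero)
    then have "(\<lambda>n. sqrt (T n \<omega>)) \<longlonglongrightarrow> 0" using tendsto_real_sqrt[of _ 0] by force
    then have "(\<lambda>n. (\<Sum>k<n\<^sup>2. X k \<omega>) / real (n\<^sup>2)) \<longlonglongrightarrow> 0"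
      by (intro tendsto_rabs_zero_cancel[where f = "\<lambda>n. (\<Sum>k<n\<^sup>2. X k \<omega>) / real (n\<^sup>2)"]) (simp add: T_def)
    then show "cesaro_null (\<lambda>k. X k \<omega>)"
      by (rule cesaro_null_squares[rotated]) (rule bounded)
  qed
qed

section \<open>Energy balance of a threshold policy\<close>

text \<open>
  \<open>c\<close> is the number of stored contents and \<open>e\<close> the battery level; \<open>D k\<close> says that the content
  removed in slot \<open>k\<close> is a stored one. \<open>U\<close> is the unicast energy actually spent, \<open>L\<close> the additional
  unicast energy that an unlimited battery would have spent.
\<close>
locale threshold_path =
  fixes N C :: nat and c :: "nat \<Rightarrow> nat" and e U L a :: "nat \<Rightarrow> real" and D :: "nat \<Rightarrow> bool"
    and pc Ep Abar w b :: real
  assumes N: "1 \<le> N" and pc: "0 < pc" "pc \<le> 1" and C_le: "C \<le> N" and Ep: "0 < Ep" and w: "0 \<le> w"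
    and c_le: "\<And>k. c k \<le> N"
    and c_Suc: "\<And>k. c (Suc k) + of_bool (D k) = c k + of_bool (c k < C \<and> Ep \<le> e k)"
    and e_Suc: "\<And>k. e (Suc k) = e k - Ep * of_bool (c k < C \<and> Ep \<le> e k) - U k + a k"
    and U_nonneg: "\<And>k. 0 \<le> U k" and U_le: "\<And>k. U k \<le> b"
    and U_below: "\<And>k. c k < C \<Longrightarrow> U k = 0"
    and L_nonneg: "\<And>k. 0 \<le> L k" and L_le: "\<And>k. L k \<le> b"
    and L_low: "\<And>k. L k \<noteq> 0 \<Longrightarrow> c k = C \<and> e k \<le> b"
    and removal_mean: "\<And>j. j \<le> N \<Longrightarrow>
      cesaro_null (\<lambda>k. of_bool (c k = j) * (of_bool (D k) - pc * real j / real N))"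
    and removal_push_mean:
      "cesaro_null (\<lambda>k. of_bool (Ep \<le> e k \<and> c k + 1 = C) * (of_bool (D k) - pc * (real C - 1) / real N))"
    and unicast_mean: "cesaro_null (\<lambda>k. of_bool (c k = C) * (U k + L k - w))"
    and harvest_mean: "\<And>\<epsilon>. 0 < \<epsilon> \<Longrightarrow> \<exists>Z. cesaro_null Z \<and> (\<forall>k. Abar - \<epsilon> + Z k \<le> a k)"
    and budget: "pc * real C / (real N + pc) * Ep + (1 - pc * real C / (real N + pc)) * w \<le> Abar"
begin

text \<open>Stationary weight of level \<open>C - 1\<close> in the chain on the levels
  \<open>C - 1\<close> and \<open>C\<close> that moves down with probability \<open>t * C\<close>
  and up with probability \<open>1 - t * (C - 1)\<close>.\<close>

definition "\<phi> = pc * real C / (real N + pc)"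
definition "t = pc / real N"
definition "full k = (of_bool (c k = C) :: real)"
definition "over k = (of_bool (C < c k) :: real)"
definition "below k = (of_bool (c k < C) :: real)"
text \<open>Kept apart from \<open>push\<close> because only a push at level \<open>C - 1\<close>
  can carry the cache into level \<open>C\<close>.\<close>

definition "refill k = (of_bool (Ep \<le> e k \<and> c k + 1 = C) :: real)"
definition "push k = (of_bool (c k < C \<and> Ep \<le> e k) :: real)"
definition "starved k = (of_bool (c k < C \<and> e k < Ep) :: real)"
text \<open>Measured from \<open>C - 1\<close> and not from \<open>C\<close>: level
  \<open>C - 1\<close> belongs to normal operation, so only the distance beyond it can be
  negligible.\<close>

definition "deficit k = below k * (real C - 1 - real (c k))"

section \<open>Elementary relations between the slot indicators\<close>

lemma t_pos: "0 < t"
  using N pc by (simp add: t_def)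

lemma \<phi>_eq: "\<phi> = t * real C / (1 + t)"
  using N pc by (simp add: \<phi>_def t_def field_simps)

lemma \<phi>_bounds: "0 \<le> \<phi>" "\<phi> < 1"
proof -
  show "0 \<le> \<phi>" using pc by (simp add: \<phi>_def)
  have "pc * real C \<le> 1 * real N" using pc C_le by (intro mult_mono) auto
  then show "\<phi> < 1" using pc N by (simp add: \<phi>_def)
qed

lemma partition: "full k + over k + below k = 1"
  by (auto simp: full_def over_def below_def)

lemma zero_le_over: "0 \<le> over k"
  by (simp add: over_def)

lemma starved_eq: "starved k = below k - push k"
  by (auto simp: starved_def below_def push_def)

lemma refill_le_below: "refill k \<le> below k"
  by (auto simp: refill_def below_def)

lemma deficit_nonneg: "0 \<le> deficit k"
  by (auto simp: deficit_def below_def)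

lemma cache_eq: "real (c k) = real C - below k - deficit k + over k * (real (c k) - real C)"
  by (auto simp: deficit_def below_def over_def)

text \<open>The chance of losing a stored content depends on the cache level, while each law of
  large numbers concerns a fixed function of the input. Splitting over the finitely many levels
  \<open>j\<close> reconciles the two.\<close>

lemma null_removal: "cesaro_null (\<lambda>k. of_bool (D k) - t * real (c k))"
proof -
  have "cesaro_null (\<lambda>k. \<Sum>j\<le>N. of_bool (c k = j) * (of_bool (D k) - pc * real j / real N))"
    by (intro cesaro_null_sum removal_mean) auto
  moreover have "(\<Sum>j\<le>N. of_bool (c k = j) * (of_bool (D k) - pc * real j / real N)) = of_bool (D k) - t * real (c k)" for k
  proof -
    have "(\<Sum>j\<le>N. of_bool (c k = j) * (of_bool (D k) - pc * real j / real N)) =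
      (\<Sum>j\<le>N. if c k = j then of_bool (D k) - pc * real j / real N else 0)"
      by (intro sum.cong) auto
    then show ?thesis using c_le[of k] by (simp add: t_def)
  qed
  ultimately show ?thesis by simp
qed

lemma null_push: "cesaro_null (\<lambda>k. push k - t * real (c k))"
proof -
  have "real (c (Suc k)) - real (c k) = push k - of_bool (D k)" for k
    using arg_cong[OF c_Suc[of k], of real] by (simp add: push_def)
  then have "cesaro_null (\<lambda>k. push k - of_bool (D k))"
    using cesaro_null_telescope[of "\<lambda>k. real (c k)" "real N"] c_le by simp
  from cesaro_null_add[OF this null_removal] show ?thesis by simp
qed

text \<open>Pushes stop at \<open>C\<close>, so \<open>max C (c k)\<close> never increases, and it
  decreases exactly at removals above \<open>C\<close>. Such removals are therefore negligible, and
  since above \<open>C\<close> they occur at rate at least \<open>t\<close>, so is the time spent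
  there.\<close>

lemma null_over: "cesaro_null over"
proof -
  have "real (max C (c (Suc k))) - real (max C (c k)) = - of_bool (C < c k \<and> D k)" for k
    using c_Suc[of k] by (cases "D k"; cases "c k < C \<and> Ep \<le> e k") (auto simp: max_def)
  then have "cesaro_null (\<lambda>k. - of_bool (C < c k \<and> D k))"
    using cesaro_null_telescope[of "\<lambda>k. real (max C (c k))" "real N"] c_le C_le by simp
  moreover have "cesaro_null (\<lambda>k. of_bool (C < c k) * (of_bool (D k) - t * real (c k)))"
  proof -
    have "cesaro_null (\<lambda>k. \<Sum>j\<in>{C<..N}. of_bool (c k = j) * (of_bool (D k) - pc * real j / real N))"
      by (intro cesaro_null_sum removal_mean) auto
    moreover have "(\<Sum>j\<in>{C<..N}. of_bool (c k = j) * (of_bool (D k) - pc * real j / real N)) =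
      of_bool (C < c k) * (of_bool (D k) - t * real (c k))" for k
    proof -
      have "(\<Sum>j\<in>{C<..N}. of_bool (c k = j) * (of_bool (D k) - pc * real j / real N)) =
        (\<Sum>j\<in>{C<..N}. if c k = j then of_bool (D k) - pc * real j / real N else 0)"
        by (intro sum.cong) auto
      then show ?thesis using c_le[of k] by (simp add: t_def)
    qed
    ultimately show ?thesis by simp
  qed
  \<comment> \<open>The occurrences of \<open>D k\<close> cancel. What remains is
    \<open>of_bool (C < c k) * c k\<close>, which dominates \<open>over k\<close> because
    \<open>c k\<close> is at least 1 above \<open>C\<close>.\<close>
  ultimately have "cesaro_null (\<lambda>k. - (1 / t) * (- of_bool (C < c k \<and> D k) + of_bool (C < c k) * (of_bool (D k) - t * real (c k))))"
    by (intro cesaro_null_mult_left cesaro_null_add)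
  then show ?thesis
  proof (rule cesaro_null_abs_le[rotated])
    show "\<bar>over k\<bar> \<le> - (1 / t) * (- of_bool (C < c k \<and> D k) + of_bool (C < c k) * (of_bool (D k) - t * real (c k)))" for k
      using t_pos by (cases "C < c k") (auto simp: over_def)
  qed
qed

lemma null_over_excess: "cesaro_null (\<lambda>k. over k * (real (c k) - real C))"
proof (rule cesaro_null_abs_le[OF _ cesaro_null_mult_left[OF null_over, of "real N"]])
  show "\<bar>over k * (real (c k) - real C)\<bar> \<le> real N * over k" for k
    using of_nat_mono[OF c_le[of k], where ?'a = real] by (simp add: over_def)
qed

text \<open>The indicator of \<open>C \<le> c k\<close> changes only by a push at level
  \<open>C - 1\<close> without loss of a stored content, or by a loss at level exactly
  \<open>C\<close>. Telescoping equates the two flows, and the removal laws turn them into multiples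
  of \<open>refill\<close> and \<open>full\<close>.\<close>

lemma null_flow: "cesaro_null (\<lambda>k. t * real C * full k - (1 - t * (real C - 1)) * refill k)"
proof -
  have "of_bool (C \<le> c (Suc k)) - of_bool (C \<le> c k) = refill k * (1 - of_bool (D k)) - full k * of_bool (D k)" for k
    using c_Suc[of k] by (cases "D k"; cases "c k < C \<and> Ep \<le> e k") (auto simp: refill_def full_def)
  then have 1: "cesaro_null (\<lambda>k. refill k * (1 - of_bool (D k)) - full k * of_bool (D k))"
    using cesaro_null_telescope[of "\<lambda>k. of_bool (C \<le> c k)" 1] by simp
  have 2: "cesaro_null (\<lambda>k. full k * (of_bool (D k) - pc * real C / real N))"
    using removal_mean[OF C_le] by (simp add: full_def)
  have 3: "cesaro_null (\<lambda>k. refill k * (of_bool (D k) - pc * (real C - 1) / real N))"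
    using removal_push_mean by (simp add: refill_def)
  have "cesaro_null (\<lambda>k. - 1 * ((refill k * (1 - of_bool (D k)) - full k * of_bool (D k)) +
      (full k * (of_bool (D k) - pc * real C / real N) + refill k * (of_bool (D k) - pc * (real C - 1) / real N))))"
    by (intro cesaro_null_mult_left cesaro_null_add 1 2 3)
  moreover have "- 1 * ((refill k * (1 - of_bool (D k)) - full k * of_bool (D k)) +
      (full k * (of_bool (D k) - pc * real C / real N) + refill k * (of_bool (D k) - pc * (real C - 1) / real N))) =
      t * real C * full k - (1 - t * (real C - 1)) * refill k" for k
  proof -
    have "pc * x / real N = t * x" for x by (simp add: t_def)
    then show ?thesis by (simp only:) (simp add: algebra_simps)
  qed
  ultimately show ?thesis by simp
qed

text \<open>Remainders of the two balance equations after division by \<open>1 + t\<close>. With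
  them written out, the balances are exact identities in every slot, so they can enter the slotwise
  energy estimate and be averaged only at the end.\<close>

definition "drift_err k = - ((t * real C * full k - (1 - t * (real C - 1)) * refill k) / (1 + t)) - \<phi> * over k"
definition "push_err k = (push k - t * real (c k) + t * (over k * (real (c k) - real C))) / (1 + t)"

lemma null_drift_err: "cesaro_null drift_err"
  using cesaro_null_diff[OF cesaro_null_mult_left[OF null_flow, of "- (1 / (1 + t))"] cesaro_null_mult_left[OF null_over, of \<phi>]]
  by (simp add: drift_err_def[abs_def])

lemma null_push_err: "cesaro_null push_err"
  using cesaro_null_mult_left[OF cesaro_null_add[OF null_push cesaro_null_mult_left[OF null_over_excess, of t]], of "1 / (1 + t)"]
  by (simp add: push_err_def[abs_def])

text \<open>
  The next two identities solve the two balance equations (flow across the level \<open>C\<close>, and pushes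
  versus removals) for the frequencies of the states below \<open>C\<close> and of pushes. By the second one,
  each starved slot saves a fixed fraction of a push in the long run.
\<close>
lemma below_eq: "below k = \<phi> + (1 - \<phi>) * (below k - refill k) + drift_err k"
proof -
  have f: "full k = 1 - over k - below k" using partition[of k] by simp
  have "1 + t \<noteq> 0" using t_pos by simp
  then show ?thesis
    unfolding drift_err_def f \<phi>_eq by (simp add: divide_simps) (simp add: algebra_simps)
qed

lemma push_eq: "push k + t / (1 + t) * starved k = \<phi> - t / (1 + t) * deficit k + push_err k"
proof -
  have "1 + t \<noteq> 0" using t_pos by simp
  then show ?thesis
    unfolding push_err_def \<phi>_eq starved_eq
    by (subst cache_eq[of k]) (simp add: divide_simps, simp add: algebra_simps)
qed

text \<open>Difference of \<open>below_eq\<close> and \<open>push_eq\<close>, using that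
  \<open>starved\<close> is \<open>below\<close> minus \<open>push\<close>. Both terms on the left
  are nonnegative, so negligible starvation makes each of them negligible.\<close>

lemma starved_decomp:
  "(1 + t) * (1 - \<phi>) * (below k - refill k) + t * deficit k = starved k - (1 + t) * drift_err k + (1 + t) * push_err k"
proof -
  have pos: "1 + t \<noteq> 0" using t_pos by simp
  have "(1 + t) * (push k + t / (1 + t) * starved k) = (1 + t) * (\<phi> - t / (1 + t) * deficit k + push_err k)"
    using push_eq[of k] by simp
  then have p: "(1 + t) * push k + t * starved k = (1 + t) * \<phi> - t * deficit k + (1 + t) * push_err k"
    using pos by (simp add: distrib_left right_diff_distrib)
  have "(1 + t) * below k = (1 + t) * (\<phi> + (1 - \<phi>) * (below k - refill k) + drift_err k)"
    using below_eq[of k] by simp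
  then show ?thesis using p starved_eq[of k] by (simp add: algebra_simps)
qed

text \<open>Energy that a shortage saves in the long run: by \<open>push_eq\<close> a starved slot
  avoids the fraction \<open>t / (1 + t)\<close> of a push, whereas a missed unicast saves its whole
  energy.\<close>

definition "loss k = Ep * (t / (1 + t)) * starved k + L k"

text \<open>In each slot \<open>push_eq\<close> bounds the push energy and \<open>below_eq\<close>
  bounds the unicast time by \<open>1 - \<phi>\<close>, up to null terms. The budget pays for
  \<open>\<phi> * Ep + (1 - \<phi>) * w\<close>, so the withheld energy stays in the
  battery.\<close>

lemma energy_growth:
  assumes "0 < \<epsilon>"
  shows "\<exists>m. \<forall>n\<ge>m. (\<Sum>k<n. loss k) \<le> e n + \<epsilon> * real n"
proof -
  obtain Z where Z: "cesaro_null Z" "\<And>k. Abar - \<epsilon> / 4 + Z k \<le> a k"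
    using harvest_mean[of "\<epsilon> / 4"] assms by auto
  \<comment> \<open>\<open>W\<close> gathers all null terms. One share \<open>\<epsilon> / 4\<close>
    goes to the harvest, one to the average of \<open>W\<close>, and one to the initial level
    \<open>e 0\<close>.\<close>
  define W where "W k = Z k - Ep * push_err k - full k * (U k + L k - w) - b * over k + w * drift_err k" for k
  have "cesaro_null (\<lambda>k. full k * (U k + L k - w))"
    using unicast_mean by (simp add: full_def)
  then have W: "cesaro_null W"
    unfolding W_def[abs_def]
    by (intro cesaro_null_add cesaro_null_diff Z(1) cesaro_null_mult_left null_push_err null_drift_err null_over)
  have step: "W k - \<epsilon> / 4 \<le> e (Suc k) - e k - loss k" for k
  proof -
    have "U k + L k \<le> full k * (U k + L k) + b * over k"
      using U_le[of k] U_below[of k] L_low[of k] U_nonneg[of k]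
      by (cases "L k = 0"; cases "c k" C rule: linorder_cases) (auto simp: full_def over_def)
    moreover have "full k * w \<le> (1 - \<phi>) * w - w * drift_err k"
    proof -
      have "full k = 1 - over k - below k" using partition[of k] by simp
      then have "full k \<le> 1 - \<phi> - drift_err k"
        using below_eq[of k] mult_nonneg_nonneg[of "1 - \<phi>" "below k - refill k"]
          \<phi>_bounds refill_le_below[of k] zero_le_over[of k] by linarith
      then have "full k * w \<le> (1 - \<phi> - drift_err k) * w" using w by (rule mult_right_mono)
      then show ?thesis by (simp add: algebra_simps)
    qed
    moreover have "Ep * (push k + t / (1 + t) * starved k) \<le> Ep * (\<phi> + push_err k)"
      unfolding push_eq using Ep t_pos deficit_nonneg[of k] by (intro mult_left_mono) auto
    ultimately show ?thesis
      using Z(2)[of k] budget e_Suc[of k]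
      unfolding W_def loss_def push_def[symmetric] \<phi>_def[symmetric] by (simp add: algebra_simps)
  qed
  obtain m where m: "\<And>n. m \<le> n \<Longrightarrow> \<bar>\<Sum>k<n. W k\<bar> \<le> \<epsilon> / 4 * real n"
    using cesaro_nullD[OF W, of "\<epsilon> / 4"] assms by auto
  obtain m' where m': "\<bar>e 0\<bar> / (\<epsilon> / 4) \<le> real m'"
    using real_arch_simple by blast
  have "(\<Sum>k<n. loss k) \<le> e n + \<epsilon> * real n" if "max m m' \<le> n" for n
  proof -
    have "(\<Sum>k<n. W k - \<epsilon> / 4) \<le> (\<Sum>k<n. e (Suc k) - e k - loss k)"
      by (intro sum_mono step)
    then have "(\<Sum>k<n. W k) - real n * (\<epsilon> / 4) \<le> e n - e 0 - (\<Sum>k<n. loss k)"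
      by (simp add: sum_subtractf sum_lessThan_telescope[symmetric])
    moreover have "\<bar>e 0\<bar> \<le> \<epsilon> / 4 * real n"
    proof -
      have "\<bar>e 0\<bar> / (\<epsilon> / 4) \<le> real n" using m' that by (auto intro: order_trans)
      then show ?thesis using assms by (simp add: field_simps)
    qed
    ultimately show ?thesis using m[of n] that assms by (simp add: algebra_simps)
  qed
  then show ?thesis by blast
qed

lemma null_loss: "cesaro_null loss"
proof (rule cesaro_null_selflimiting[OF _ _ _ energy_growth])
  have k: "0 \<le> Ep * (t / (1 + t))" using Ep t_pos by simp
  show "0 \<le> loss k" for k
    using k L_nonneg[of k] by (simp add: loss_def starved_def)
  show "loss k \<le> Ep * (t / (1 + t)) + b" for k
    using k L_le[of k] by (simp add: loss_def starved_def)
  show "loss k \<noteq> 0 \<Longrightarrow> e k \<le> max Ep b" for k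
    using L_low[of k] by (cases "L k = 0") (auto simp: loss_def starved_def)
qed

lemma null_starved: "cesaro_null starved"
proof (rule cesaro_null_abs_le[OF _ cesaro_null_mult_left[OF null_loss, of "1 / (Ep * (t / (1 + t)))"]])
  have scale: "x \<le> 1 / A * (A * x + y)" if "0 < A" "0 \<le> y" for A x y :: real
    using that by (simp add: field_simps)
  show "\<bar>starved k\<bar> \<le> 1 / (Ep * (t / (1 + t))) * loss k" for k
  proof -
    have "starved k \<le> 1 / (Ep * (t / (1 + t))) * (Ep * (t / (1 + t)) * starved k + L k)"
      using Ep t_pos L_nonneg by (intro scale) auto
    moreover have "\<bar>starved k\<bar> = starved k" by (simp add: starved_def)
    ultimately show ?thesis by (simp only: loss_def)
  qed
qed

lemma null_missed: "cesaro_null L"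
proof (rule cesaro_null_abs_le[OF _ null_loss])
  show "\<bar>L k\<bar> \<le> loss k" for k
    using Ep t_pos L_nonneg[of k] by (simp add: loss_def starved_def)
qed

lemma null_decomp: "cesaro_null (\<lambda>k. (1 + t) * (1 - \<phi>) * (below k - refill k) + t * deficit k)"
  unfolding starved_decomp
  by (intro cesaro_null_add cesaro_null_diff cesaro_null_mult_left null_starved null_drift_err null_push_err)

lemma null_deficit: "cesaro_null deficit"
proof (rule cesaro_null_abs_le[OF _ cesaro_null_mult_left[OF null_decomp, of "1 / t"]])
  show "\<bar>deficit k\<bar> \<le> 1 / t * ((1 + t) * (1 - \<phi>) * (below k - refill k) + t * deficit k)" for k
  proof -
    have "0 \<le> (1 + t) * (1 - \<phi>) * (below k - refill k)"
      using t_pos \<phi>_bounds refill_le_below[of k] by simp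
    then show ?thesis using t_pos deficit_nonneg[of k] by (simp add: field_simps)
  qed
qed

lemma null_idle: "cesaro_null (\<lambda>k. below k - refill k)"
proof (rule cesaro_null_abs_le[OF _ cesaro_null_mult_left[OF null_decomp, of "1 / ((1 + t) * (1 - \<phi>))"]])
  show "\<bar>below k - refill k\<bar> \<le> 1 / ((1 + t) * (1 - \<phi>)) * ((1 + t) * (1 - \<phi>) * (below k - refill k) + t * deficit k)" for k
  proof -
    have "0 < (1 + t) * (1 - \<phi>)" using t_pos \<phi>_bounds by simp
    moreover have "0 \<le> t * deficit k" using t_pos deficit_nonneg[of k] by simp
    moreover have "1 / A * (A * x + y) = x + y / A" if "0 < A" for A x y :: real
      using that by (simp add: field_simps)
    ultimately show ?thesis using refill_le_below[of k] by (simp add: divide_nonneg_pos)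
  qed
qed

section \<open>Limiting frequencies of the levels C - 1 and C\<close>

lemma refill_frequency: "cesaro_null (\<lambda>k. refill k - \<phi>)"
proof -
  have "cesaro_null (\<lambda>k. drift_err k - \<phi> * (below k - refill k))"
    by (intro cesaro_null_diff cesaro_null_mult_left null_drift_err null_idle)
  moreover have "drift_err k - \<phi> * (below k - refill k) = refill k - \<phi>" for k
    using below_eq[of k] by (simp add: algebra_simps)
  ultimately show ?thesis by simp
qed

lemma full_frequency: "cesaro_null (\<lambda>k. full k - (1 - \<phi>))"
proof -
  have "cesaro_null (\<lambda>k. - (refill k - \<phi>) - (below k - refill k) - over k)"
    by (intro cesaro_null_diff cesaro_null_minus refill_frequency null_idle null_over)
  moreover have "- (refill k - \<phi>) - (below k - refill k) - over k = full k - (1 - \<phi>)" for k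
    using partition[of k] by simp
  ultimately show ?thesis by (simp only:)
qed

end

section \<open>Sample paths of the policy\<close>

abbreviation removal :: "slot_input \<Rightarrow> bool" where "removal x \<equiv> fst x"
abbreviation removed_rank :: "slot_input \<Rightarrow> nat" where "removed_rank x \<equiv> fst (snd x)"
abbreviation request :: "slot_input \<Rightarrow> bool" where "request x \<equiv> fst (snd (snd x))"
abbreviation requested_rank :: "slot_input \<Rightarrow> nat" where "requested_rank x \<equiv> fst (snd (snd (snd x)))"
abbreviation radius :: "slot_input \<Rightarrow> real" where "radius x \<equiv> cmod (fst (snd (snd (snd (snd x)))))"
abbreviation harvest :: "slot_input \<Rightarrow> real" where "harvest x \<equiv> snd (snd (snd (snd (snd x))))"

text \<open>Serves two purposes: the state at \<open>k\<close> is a function of the inputs before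
  \<open>k\<close>, which yields independence from input \<open>k\<close>; and \<open>Eu\<close> may
  be exchanged for an extension that agrees with it on the disk.\<close>

lemma eetb_state_cong:
  assumes "\<And>j. j < k \<Longrightarrow> xs j = ys j"
    and "\<And>j. j < k \<Longrightarrow> Eu (radius (ys j)) = Eu' (radius (ys j))" and "Eu dt = Eu' dt"
  shows "eetb_state C Ep Eu dt s xs k = eetb_state C Ep Eu' dt s ys k"
  using assms(1,2)
proof (induction k)
  case (Suc k)
  have "eetb_unicast C Eu dt z (ys k) = eetb_unicast C Eu' dt z (ys k)" for z
    using Suc.prems(2)[of k] by (simp add: eetb_unicast_def case_prod_unfold assms(3))
  moreover have "Eu (radius (ys k)) = Eu' (radius (ys k))"
    using Suc.prems(2) by simp
  ultimately show ?case
    using Suc by (simp add: eetb_step_def case_prod_unfold Let_def)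
qed simp

locale eetb_params =
  fixes N C :: nat and pc R Ep dt :: real and Eu :: "real \<Rightarrow> real"
  assumes N: "1 \<le> N" and pc: "0 < pc" "pc \<le> 1" and C_le: "C \<le> N" and R: "0 < R" and Ep: "0 < Ep"
    and Eu_cont: "continuous_on UNIV Eu" and Eu_mono: "strict_mono_on {0..R} Eu"
    and Eu_nonneg: "\<And>d. d \<in> {0..R} \<Longrightarrow> 0 \<le> Eu d" and dt: "dt \<in> {0..R}"
begin

lemma Eu_pos: "0 < d \<Longrightarrow> d \<le> R \<Longrightarrow> 0 < Eu d"
  using strict_mono_onD[OF Eu_mono, of 0 d] Eu_nonneg[of 0] by auto

lemma Eu_le_iff: "d \<in> {0..R} \<Longrightarrow> d' \<in> {0..R} \<Longrightarrow> Eu d \<le> Eu d' \<longleftrightarrow> d \<le> d'"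
  using strict_mono_on_less_eq[OF Eu_mono] by blast

end

text \<open>Everything that probability contributes, stated for a single path. Here \<open>w\<close>
  is the mean unicast energy requested within distance \<open>dt\<close>, \<open>\<rho>\<close> the
  chance of a request beyond rank \<open>C\<close>, and \<open>\<rho>'\<close> the chance of such a
  request from farther than \<open>dt\<close>. Radius 0 is excluded because \<open>Eu 0\<close> may
  be 0, and the policy unicasts only at positive cost.\<close>

locale eetb_path = eetb_params +
  fixes xs :: "nat \<Rightarrow> slot_input" and s :: "nat \<times> real" and Abar w \<rho> \<rho>' :: real
  assumes init: "fst s \<le> N"
    and removed_rank: "\<And>k. 1 \<le> removed_rank (xs k)"
    and radius: "\<And>k. 0 < radius (xs k)" "\<And>k. radius (xs k) \<le> R"
    and w: "0 \<le> w"
    and budget: "pc * real C / (real N + pc) * Ep + (1 - pc * real C / (real N + pc)) * w \<le> Abar"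
    and removal_mean: "\<And>j. j \<le> N \<Longrightarrow>
      cesaro_null (\<lambda>k. of_bool (fst (eetb_state C Ep Eu dt s xs k) = j) *
        (of_bool (removal (xs k) \<and> removed_rank (xs k) \<le> j) - pc * real j / real N))"
    and removal_push_mean: "1 \<le> C \<Longrightarrow>
      cesaro_null (\<lambda>k. of_bool (Ep \<le> snd (eetb_state C Ep Eu dt s xs k) \<and> fst (eetb_state C Ep Eu dt s xs k) + 1 = C) *
        (of_bool (removal (xs k) \<and> removed_rank (xs k) \<le> C - 1) - pc * real (C - 1) / real N))"
    and unicast_mean:
      "cesaro_null (\<lambda>k. of_bool (fst (eetb_state C Ep Eu dt s xs k) = C) *
        (of_bool (request (xs k) \<and> C < requested_rank (xs k) \<and> radius (xs k) \<le> dt) * Eu (radius (xs k)) - w))"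
    and miss_push_mean:
      "cesaro_null (\<lambda>k. of_bool (Ep \<le> snd (eetb_state C Ep Eu dt s xs k) \<and> fst (eetb_state C Ep Eu dt s xs k) + 1 = C) *
        (of_bool (request (xs k) \<and> C < requested_rank (xs k)) - \<rho>))"
    and miss_far_mean:
      "cesaro_null (\<lambda>k. of_bool (fst (eetb_state C Ep Eu dt s xs k) = C) *
        (of_bool (request (xs k) \<and> C < requested_rank (xs k) \<and> dt < radius (xs k)) - \<rho>'))"
    and radius_mean: "\<And>n. cesaro_null (\<lambda>k. of_bool (radius (xs k) \<le> R / real (Suc n)) - (1 / real (Suc n))\<^sup>2)"
    and harvest_mean: "\<And>\<epsilon>. 0 < \<epsilon> \<Longrightarrow> \<exists>Z. cesaro_null Z \<and> (\<forall>k. Abar - \<epsilon> + Z k \<le> harvest (xs k))"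
begin

definition "st k = eetb_state C Ep Eu dt s xs k"
definition "unicast k \<longleftrightarrow> eetb_unicast C Eu dt (st k) (xs k)"
text \<open>A unicast prevented by the battery alone. Only level exactly \<open>C\<close> is
  recorded, since slots above \<open>C\<close> are negligible by \<open>null_over\<close>.\<close>

definition "missed k \<longleftrightarrow> fst (st k) = C \<and> request (xs k) \<and> C < requested_rank (xs k)
  \<and> radius (xs k) \<le> dt \<and> snd (st k) < Eu (radius (xs k))"

lemma radius_pos_Eu: "0 < Eu (radius (xs k))"
  using Eu_pos radius by blast

lemma radius_le_dt: "Eu (radius (xs k)) \<le> Eu dt \<longleftrightarrow> radius (xs k) \<le> dt"
  using Eu_le_iff radius dt by (simp add: less_imp_le)

text \<open>The policy compares energies, the law of the requester concerns distances; strict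
  monotonicity of \<open>Eu\<close> translates between them.\<close>

lemma unicast_iff: "unicast k \<longleftrightarrow> C \<le> fst (st k) \<and> request (xs k) \<and> fst (st k) < requested_rank (xs k)
  \<and> radius (xs k) \<le> dt \<and> Eu (radius (xs k)) \<le> snd (st k)"
  using radius_pos_Eu[of k] radius_le_dt[of k] by (auto simp: unicast_def eetb_unicast_def case_prod_unfold)

lemma st_Suc: "st (Suc k) = eetb_step C Ep Eu dt (st k) (xs k)"
  by (simp add: st_def)

lemma cache_Suc:
  "fst (st (Suc k)) + of_bool (removal (xs k) \<and> removed_rank (xs k) \<le> fst (st k)) =
    fst (st k) + of_bool (fst (st k) < C \<and> Ep \<le> snd (st k))"
  using removed_rank[of k] by (auto simp: st_Suc eetb_step_def eetb_push_def case_prod_unfold Let_def)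

lemma battery_Suc:
  "snd (st (Suc k)) = snd (st k) - Ep * of_bool (fst (st k) < C \<and> Ep \<le> snd (st k))
    - of_bool (unicast k) * Eu (radius (xs k)) + harvest (xs k)"
  by (auto simp: st_Suc eetb_step_def eetb_push_def unicast_def eetb_unicast_def case_prod_unfold Let_def)

lemma cache_le: "fst (st k) \<le> N"
proof (induction k)
  case 0
  show ?case using init by (simp add: st_def)
next
  case (Suc k)
  then show ?case using cache_Suc[of k] C_le
    by (cases "fst (st k) < C \<and> Ep \<le> snd (st k)") auto
qed

sublocale threshold_path N C "\<lambda>k. fst (st k)" "\<lambda>k. snd (st k)"
  "\<lambda>k. of_bool (unicast k) * Eu (radius (xs k))" "\<lambda>k. of_bool (missed k) * Eu (radius (xs k))"
  "\<lambda>k. harvest (xs k)" "\<lambda>k. removal (xs k) \<and> removed_rank (xs k) \<le> fst (st k)" pc Ep Abar w "Eu dt"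
proof
  fix k
  have Eu_le: "radius (xs k) \<le> dt \<Longrightarrow> Eu (radius (xs k)) \<le> Eu dt"
    using radius_le_dt by blast
  have Eu_dt: "0 \<le> Eu dt" using Eu_nonneg dt by blast
  show "0 \<le> of_bool (unicast k) * Eu (radius (xs k))" "0 \<le> of_bool (missed k) * Eu (radius (xs k))"
    using radius_pos_Eu[of k] by auto
  show "of_bool (unicast k) * Eu (radius (xs k)) \<le> Eu dt" "of_bool (missed k) * Eu (radius (xs k)) \<le> Eu dt"
    using Eu_le Eu_dt by (auto simp: unicast_iff missed_def)
  show "fst (st k) < C \<Longrightarrow> of_bool (unicast k) * Eu (radius (xs k)) = 0"
    by (auto simp: unicast_iff)
  show "of_bool (missed k) * Eu (radius (xs k)) \<noteq> 0 \<Longrightarrow> fst (st k) = C \<and> snd (st k) \<le> Eu dt"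
    using Eu_le by (auto simp: missed_def)
next
  fix j assume "j \<le> N"
  have "of_bool (fst (st k) = j) * (of_bool (removal (xs k) \<and> removed_rank (xs k) \<le> fst (st k)) - pc * real j / real N) =
    of_bool (fst (st k) = j) * (of_bool (removal (xs k) \<and> removed_rank (xs k) \<le> j) - pc * real j / real N)" for k
    by auto
  then show "cesaro_null (\<lambda>k. of_bool (fst (st k) = j) * (of_bool (removal (xs k) \<and> removed_rank (xs k) \<le> fst (st k)) - pc * real j / real N))"
    using removal_mean[OF \<open>j \<le> N\<close>, folded st_def] by (simp only:)
next
  show "cesaro_null (\<lambda>k. of_bool (Ep \<le> snd (st k) \<and> fst (st k) + 1 = C) *
    (of_bool (removal (xs k) \<and> removed_rank (xs k) \<le> fst (st k)) - pc * (real C - 1) / real N))"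
  \<comment> \<open>\<open>real C - 1\<close> and \<open>real (C - 1)\<close> differ for
    \<open>C = 0\<close>; there the indicator in front is zero.\<close>
  proof (cases "1 \<le> C")
    case True
    have "of_bool (Ep \<le> snd (st k) \<and> fst (st k) + 1 = C) *
        (of_bool (removal (xs k) \<and> removed_rank (xs k) \<le> fst (st k)) - pc * (real C - 1) / real N) =
      of_bool (Ep \<le> snd (st k) \<and> fst (st k) + 1 = C) *
        (of_bool (removal (xs k) \<and> removed_rank (xs k) \<le> C - 1) - pc * real (C - 1) / real N)" for k
      using True by (auto simp: of_nat_diff)
    then show ?thesis
      using removal_push_mean[OF True, folded st_def] by (simp only:)
  next
    case False
    then have "of_bool (Ep \<le> snd (st k) \<and> fst (st k) + 1 = C) = (0 :: real)" for k by auto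
    then show ?thesis by (simp only: mult_zero_left cesaro_null_zero)
  qed
next
  \<comment> \<open>The battery only decides whether a requested unicast counts in \<open>U\<close>
    or in \<open>L\<close>. At level \<open>C\<close> their sum depends on the current input alone
    and so has mean \<open>w\<close>.\<close>
  have "of_bool (fst (st k) = C) * (of_bool (unicast k) * Eu (radius (xs k)) + of_bool (missed k) * Eu (radius (xs k)) - w) =
    of_bool (fst (st k) = C) * (of_bool (request (xs k) \<and> C < requested_rank (xs k) \<and> radius (xs k) \<le> dt) * Eu (radius (xs k)) - w)" for k
    by (cases "Eu (radius (xs k)) \<le> snd (st k)") (auto simp: unicast_iff missed_def)
  then show "cesaro_null (\<lambda>k. of_bool (fst (st k) = C) *
      (of_bool (unicast k) * Eu (radius (xs k)) + of_bool (missed k) * Eu (radius (xs k)) - w))"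
    using unicast_mean[folded st_def] by (simp only:)
qed (use N pc C_le Ep w cache_le cache_Suc battery_Suc budget harvest_mean in auto)

text \<open>The energy lost to missed unicasts is negligible; since short distances cost little energy,
  negligibility of their number also needs that short distances are rare.\<close>
lemma null_missed_count: "cesaro_null (\<lambda>k. of_bool (missed k))"
proof (rule cesaro_null_approxI)
  fix \<epsilon> :: real assume "0 < \<epsilon>"
  then obtain n where n: "1 / real (Suc n) < \<epsilon>"
    using reals_Archimedean by (auto simp: inverse_eq_divide)
  \<comment> \<open>The disk of radius \<open>\<delta>\<close> has relative area
    \<open>(1 / Suc n)^2\<close>, below \<open>\<epsilon>\<close>. Outside it a missed unicast costs
    at least \<open>Eu \<delta>\<close>, so the energy bound counts these misses as in Markov's
    inequality.\<close>
  define \<delta> where "\<delta> = R / real (Suc n)"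
  have \<delta>: "0 < \<delta>" "\<delta> \<le> R"
    using R by (auto simp: \<delta>_def field_simps)
  have E\<delta>: "0 < Eu \<delta>" by (intro Eu_pos \<delta>)
  have "(1 / real (Suc n))\<^sup>2 \<le> (1 / real (Suc n)) * 1"
    unfolding power2_eq_square by (intro mult_left_mono) auto
  then have sq: "(1 / real (Suc n))\<^sup>2 \<le> \<epsilon>" using n by simp
  define Y where "Y k = 1 / Eu \<delta> * (of_bool (missed k) * Eu (radius (xs k))) + (of_bool (radius (xs k) \<le> \<delta>) - (1 / real (Suc n))\<^sup>2)" for k
  have "cesaro_null Y"
    unfolding Y_def[abs_def] \<delta>_def
    by (intro cesaro_null_add cesaro_null_mult_left null_missed radius_mean)
  moreover have "of_bool (missed k) \<le> Y k + \<epsilon>" for k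
  proof (cases "missed k \<and> \<delta> < radius (xs k)")
    case True
    have "Eu \<delta> \<le> Eu (radius (xs k))"
      using Eu_le_iff[of \<delta> "radius (xs k)"] \<delta> True radius[of k] by simp
    then have "1 \<le> 1 / Eu \<delta> * Eu (radius (xs k))" using E\<delta> by simp
    then show ?thesis using True sq by (simp add: Y_def)
  next
    case False
    have "0 \<le> 1 / Eu \<delta> * (of_bool (missed k) * Eu (radius (xs k)))"
      using E\<delta> radius_pos_Eu[of k] by simp
    moreover have "of_bool (missed k) \<le> (of_bool (radius (xs k) \<le> \<delta>) :: real)"
      using False by auto
    ultimately show ?thesis using sq unfolding Y_def by linarith
  qed
  ultimately show "\<exists>Y. cesaro_null Y \<and> (\<forall>k. of_bool (missed k) \<le> Y k + \<epsilon>)" by blast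
qed auto

text \<open>In a push slot at level \<open>C - 1\<close> the request for rank \<open>C\<close> is
  served by the push, so blocking means a rank beyond \<open>C\<close>, as at level
  \<open>C\<close>. At \<open>C\<close> the blocked requests are the far ones together with the
  missed ones. Every other state is charged to \<open>starved\<close>, \<open>deficit\<close> or
  \<open>over\<close>.\<close>

lemma blocked_decomp:
  fixes k
  defines "X \<equiv> refill k * of_bool (request (xs k) \<and> C < requested_rank (xs k)) +
    full k * of_bool (request (xs k) \<and> C < requested_rank (xs k) \<and> dt < radius (xs k))"
  shows "\<bar>of_bool (eetb_blocked C Ep Eu dt s xs k) - X\<bar> \<le> starved k + deficit k + over k + of_bool (missed k)"
proof -
  have blocked: "eetb_blocked C Ep Eu dt s xs k \<longleftrightarrow> request (xs k) \<and> fst (st k) < requested_rank (xs k)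
      \<and> \<not> unicast k \<and> \<not> (fst (st k) < C \<and> Ep \<le> snd (st k) \<and> requested_rank (xs k) = fst (st k) + 1)"
    by (auto simp: eetb_blocked_def Let_def case_prod_unfold st_def unicast_def eetb_push_def)
  have nonneg: "0 \<le> starved k" "0 \<le> over k" "0 \<le> deficit k"
    using deficit_nonneg by (auto simp: starved_def over_def)
  have le1: "\<bar>of_bool P - of_bool Q\<bar> \<le> (1 :: real)" for P Q by auto
  consider "C < fst (st k)" | "fst (st k) = C" | "fst (st k) < C" "snd (st k) < Ep" |
    "fst (st k) + 1 < C" "Ep \<le> snd (st k)" | "fst (st k) + 1 = C" "Ep \<le> snd (st k)"
    by linarith
  then show ?thesis
  proof cases
    case 1
    then have "X = 0" "over k = 1" by (auto simp: X_def refill_def full_def over_def)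
    then show ?thesis using nonneg by auto
  next
    case 2
    then have "of_bool (eetb_blocked C Ep Eu dt s xs k) - X = of_bool (missed k)"
      by (auto simp: X_def refill_def full_def blocked unicast_iff missed_def)
    then show ?thesis using nonneg by simp
  next
    case 3
    then have "X = 0" "starved k = 1" by (auto simp: X_def refill_def full_def starved_def)
    then show ?thesis using nonneg by auto
  next
    case 4
    then have "X = 0" "1 \<le> deficit k"
      by (auto simp: X_def refill_def full_def deficit_def below_def)
    then show ?thesis using nonneg by auto
  next
    case 5
    then have "of_bool (eetb_blocked C Ep Eu dt s xs k) - X = 0"
      by (auto simp: X_def refill_def full_def blocked unicast_iff)
    then show ?thesis using nonneg by simp
  qed
qed

lemma blocked_frequency:
  "(\<lambda>K. real (card {k. k < K \<and> eetb_blocked C Ep Eu dt s xs k}) / real K) \<longlonglongrightarrow> \<phi> * \<rho> + (1 - \<phi>) * \<rho>'"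
proof -
  define B where "B k = (of_bool (eetb_blocked C Ep Eu dt s xs k) :: real)" for k
  define X where "X k = refill k * of_bool (request (xs k) \<and> C < requested_rank (xs k)) +
    full k * of_bool (request (xs k) \<and> C < requested_rank (xs k) \<and> dt < radius (xs k))" for k
  have "cesaro_null (\<lambda>k. B k - X k)"
  proof (rule cesaro_null_abs_le)
    show "\<bar>B k - X k\<bar> \<le> starved k + deficit k + over k + of_bool (missed k)" for k
      unfolding B_def X_def by (rule blocked_decomp)
    show "cesaro_null (\<lambda>k. starved k + deficit k + over k + of_bool (missed k))"
      by (intro cesaro_null_add null_starved null_deficit null_over null_missed_count)
  qed
  moreover have "cesaro_null (\<lambda>k. refill k * (of_bool (request (xs k) \<and> C < requested_rank (xs k)) - \<rho>))"
    using miss_push_mean[folded st_def] by (simp only: refill_def)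
  moreover have "cesaro_null (\<lambda>k. full k * (of_bool (request (xs k) \<and> C < requested_rank (xs k) \<and> dt < radius (xs k)) - \<rho>'))"
    using miss_far_mean[folded st_def] by (simp only: full_def)
  \<comment> \<open>Two replacements in one sum: on each level the input indicators become their
    means \<open>\<rho>\<close> and \<open>\<rho>'\<close>, and then the level indicators become
    \<open>\<phi>\<close> and \<open>1 - \<phi>\<close>.\<close>
  ultimately have "cesaro_null (\<lambda>k. (B k - X k) + refill k * (of_bool (request (xs k) \<and> C < requested_rank (xs k)) - \<rho>)
      + full k * (of_bool (request (xs k) \<and> C < requested_rank (xs k) \<and> dt < radius (xs k)) - \<rho>')
      + \<rho> * (refill k - \<phi>) + \<rho>' * (full k - (1 - \<phi>)))"
    by (intro cesaro_null_add cesaro_null_mult_left refill_frequency full_frequency)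
  moreover have "(B k - X k) + refill k * (of_bool (request (xs k) \<and> C < requested_rank (xs k)) - \<rho>)
      + full k * (of_bool (request (xs k) \<and> C < requested_rank (xs k) \<and> dt < radius (xs k)) - \<rho>')
      + \<rho> * (refill k - \<phi>) + \<rho>' * (full k - (1 - \<phi>)) = B k - (\<phi> * \<rho> + (1 - \<phi>) * \<rho>')" for k
    unfolding X_def by (simp add: algebra_simps)
  ultimately have "cesaro_null (\<lambda>k. B k - (\<phi> * \<rho> + (1 - \<phi>) * \<rho>'))" by (simp only:)
  then have "(\<lambda>K. (\<Sum>k<K. B k - (\<phi> * \<rho> + (1 - \<phi>) * \<rho>')) / real K + (\<phi> * \<rho> + (1 - \<phi>) * \<rho>')) \<longlonglongrightarrow> 0 + (\<phi> * \<rho> + (1 - \<phi>) * \<rho>')"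
    unfolding cesaro_null_def by (intro tendsto_add tendsto_const)
  moreover have "\<forall>\<^sub>F K in sequentially. (\<Sum>k<K. B k - (\<phi> * \<rho> + (1 - \<phi>) * \<rho>')) / real K + (\<phi> * \<rho> + (1 - \<phi>) * \<rho>') =
      real (card {k. k < K \<and> eetb_blocked C Ep Eu dt s xs k}) / real K"
      using eventually_gt_at_top[of 0]
    proof eventually_elim
      case (elim K)
      have "{..<K} \<inter> {k. eetb_blocked C Ep Eu dt s xs k} = {k. k < K \<and> eetb_blocked C Ep Eu dt s xs k}" by auto
      then have "(\<Sum>k<K. B k) = real (card {k. k < K \<and> eetb_blocked C Ep Eu dt s xs k})"
        by (simp add: B_def)
      then show ?case using elim by (simp add: sum_subtractf diff_divide_distrib)
    qed
  ultimately show ?thesis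
    by (simp only: tendsto_cong add_0)
qed

end

section \<open>Distribution of one slot\<close>

lemma prob_space_integral_pair_mult:
  fixes f :: "'a \<Rightarrow> real" and g :: "'b \<Rightarrow> real"
  assumes "prob_space A" and "prob_space B"
    and [measurable]: "f \<in> borel_measurable A" "g \<in> borel_measurable B"
    and "bounded (range f)" and "bounded (range g)"
  shows "(\<integral>p. f (fst p) * g (snd p) \<partial>(A \<Otimes>\<^sub>M B)) = (\<integral>x. f x \<partial>A) * (\<integral>y. g y \<partial>B)"
proof -
  interpret A: prob_space A by fact
  interpret B: prob_space B by fact
  interpret AB: pair_prob_space A B ..
  obtain b c where b: "\<And>x. \<bar>f x\<bar> \<le> b" and c: "\<And>y. \<bar>g y\<bar> \<le> c"
    using assms(5,6) by (auto simp: bounded_iff)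
  have "0 \<le> b" using b[of undefined] by linarith
  then have "\<bar>f x * g y\<bar> \<le> b * c" for x y
    unfolding abs_mult by (intro mult_mono b c) auto
  then have "integrable (A \<Otimes>\<^sub>M B) (\<lambda>(x, y). f x * g y)"
    by (intro AB.P.integrable_const_bound[of _ "b * c"]) auto
  then have "(\<integral>x. \<integral>y. f x * g y \<partial>B \<partial>A) = (\<integral>p. (case p of (x, y) \<Rightarrow> f x * g y) \<partial>(A \<Otimes>\<^sub>M B))"
    by (rule AB.integral_fst)
  then show ?thesis by (simp add: case_prod_unfold)
qed

lemma bounded_range_pair_mult:
  fixes f :: "'a \<Rightarrow> real" and g :: "'b \<Rightarrow> real"
  assumes "bounded (range f)" and "bounded (range g)"
  shows "bounded (range (\<lambda>p. f (fst p) * g (snd p)))"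
proof -
  obtain b c where b: "\<And>x. \<bar>f x\<bar> \<le> b" and c: "\<And>y. \<bar>g y\<bar> \<le> c"
    using assms by (auto simp: bounded_iff)
  have "0 \<le> b" using b[of undefined] by linarith
  then have "\<bar>f x * g y\<bar> \<le> b * c" for x y
    unfolding abs_mult by (intro mult_mono b c) auto
  then show ?thesis by (auto simp: bounded_iff)
qed

section \<open>Radial law of a uniform point in a disk\<close>

lemma emeasure_cball_complex:
  "0 \<le> r \<Longrightarrow> emeasure lborel (cball (z :: complex) r) = ennreal (pi * r\<^sup>2)"
  by (simp add: emeasure_cball unit_ball_vol_2)

lemma prob_space_uniform_disk:
  "0 < R \<Longrightarrow> prob_space (uniform_measure lborel (cball (0 :: complex) R))"
  by (intro prob_space_uniform_measure) (auto simp: emeasure_cball_complex)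

text \<open>Both distribution functions equal the area ratio of two disks;
  \<open>max 0 (min t R)\<close> in the proof clamps the inner radius for \<open>t\<close> outside
  \<open>{0..R}\<close>.\<close>

lemma distr_cmod_uniform_disk:
  assumes R: "0 < R"
  shows "distr (uniform_measure lborel (cball (0 :: complex) R)) borel cmod =
    density lborel (\<lambda>d. ennreal (2 * d / R\<^sup>2) * indicator {0..R} d)" (is "?L = ?D")
proof (rule cdf_unique)
  interpret U: prob_space "uniform_measure lborel (cball (0 :: complex) R)"
    using R by (rule prob_space_uniform_disk)
  show "real_distribution ?L"
    by (rule U.real_distribution_distr) simp
  have D: "emeasure ?D {..t} = ennreal ((max 0 (min t R))\<^sup>2 / R\<^sup>2)" for t
  proof -
    have "emeasure ?D {..t} = (\<integral>\<^sup>+d. ennreal (2 * d / R\<^sup>2) * indicator {0..min t R} d \<partial>lborel)"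
      by (subst emeasure_density) (auto intro!: nn_integral_cong split: split_indicator)
    also have "\<dots> = ennreal ((max 0 (min t R))\<^sup>2 / R\<^sup>2)"
    proof (cases "0 \<le> min t R")
      case True
      have "(\<integral>\<^sup>+d. ennreal (2 * d / R\<^sup>2) * indicator {0..min t R} d \<partial>lborel) =
        ennreal ((min t R)\<^sup>2 / R\<^sup>2 - 0\<^sup>2 / R\<^sup>2)"
        by (rule nn_integral_FTC_Icc) (use True R in \<open>auto intro!: derivative_eq_intros simp: field_simps eval_nat_numeral\<close>)
      then show ?thesis using True by (simp add: max_def)
    next
      case False
      then have "min t R < 0" by (simp only: not_le)
      then have "{0..min t R} = {}" and "max 0 (min t R) = 0"
        by auto
      then show ?thesis by (simp only:) simp
    qed
    finally show ?thesis .
  qed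
  have "emeasure ?D UNIV = emeasure ?D {..R}"
    by (subst (1 2) emeasure_density) (auto intro!: nn_integral_cong split: split_indicator)
  also have "\<dots> = 1" using R unfolding D by simp
  finally have "prob_space ?D" by (intro prob_spaceI) simp
  then interpret D: prob_space ?D .
  show "real_distribution ?D" by unfold_locales auto
  show "cdf ?L = cdf ?D"
  proof
    fix t
    have "emeasure ?L {..t} = emeasure ?D {..t}"
    proof (cases "0 \<le> t")
      case True
      have "cmod -` {..t} = cball 0 t" by auto
      then have "emeasure ?L {..t} = emeasure (uniform_measure lborel (cball (0 :: complex) R)) (cball 0 t)"
        by (subst emeasure_distr) (simp_all del: emeasure_uniform_measure)
      also have "\<dots> = emeasure lborel (cball (0 :: complex) R \<inter> cball 0 t) / emeasure lborel (cball (0 :: complex) R)"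
        by (rule emeasure_uniform_measure) auto
      also have "cball (0 :: complex) R \<inter> cball 0 t = cball 0 (min t R)"
        by auto
      also have "emeasure lborel (cball (0 :: complex) (min t R)) / emeasure lborel (cball (0 :: complex) R)
        = ennreal (pi * (min t R)\<^sup>2 / (pi * R\<^sup>2))"
        using True R by (simp add: emeasure_cball_complex divide_ennreal)
      also have "\<dots> = emeasure ?D {..t}"
        unfolding D using True R by (simp add: max_def)
      finally show ?thesis .
    next
      case False
      have "cmod -` {..t} = {}" using False order_trans[OF norm_ge_zero] by auto
      then have "emeasure ?L {..t} = 0"
        by (subst emeasure_distr) simp_all
      then show ?thesis using False unfolding D by (simp add: max_def)
    qed
    then show "cdf ?L t = cdf ?D t" by (simp add: cdf_def measure_def)
  qed
qed

lemma integral_uniform_disk_radial: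
  fixes h :: "real \<Rightarrow> real"
  assumes R: "0 < R" and t: "0 \<le> t" "t \<le> R" and h: "continuous_on UNIV h"
  shows "(\<integral>z. indicat_real {..t} (cmod z) * h (cmod z) \<partial>uniform_measure lborel (cball (0 :: complex) R)) =
    integral {0..t} (\<lambda>d. h d * (2 * d / R\<^sup>2))"
proof -
  have [measurable]: "h \<in> borel_measurable borel"
    using h by (rule borel_measurable_continuous_onI)
  have "(\<integral>z. indicat_real {..t} (cmod z) * h (cmod z) \<partial>uniform_measure lborel (cball (0 :: complex) R)) =
    (\<integral>d. indicat_real {..t} d * h d \<partial>distr (uniform_measure lborel (cball (0 :: complex) R)) borel cmod)"
    by (subst integral_distr) auto
  also have "\<dots> = (\<integral>d. indicat_real {..t} d * h d \<partial>density lborel (\<lambda>d. ennreal (2 * d / R\<^sup>2 * indicat_real {0..R} d)))"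
    unfolding distr_cmod_uniform_disk[OF R]
    by (intro arg_cong2[where f = lebesgue_integral] refl arg_cong2[where f = density] ext) (auto split: split_indicator)
  also have "\<dots> = (\<integral>d. (2 * d / R\<^sup>2 * indicat_real {0..R} d) * (indicat_real {..t} d * h d) \<partial>lborel)"
    by (subst integral_density) (auto split: split_indicator)
  also have "\<dots> = (LINT d:{0..t}|lborel. h d * (2 * d / R\<^sup>2))"
    unfolding set_lebesgue_integral_def
    using t by (intro Bochner_Integration.integral_cong) (auto split: split_indicator)
  also have "\<dots> = integral {0..t} (\<lambda>d. h d * (2 * d / R\<^sup>2))"
  proof (rule set_borel_integral_eq_integral)
    show "set_integrable lborel {0..t} (\<lambda>d. h d * (2 * d / R\<^sup>2))"
      by (rule borel_integrable_atLeastAtMost')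
        (use R in \<open>auto intro!: continuous_intros intro: continuous_on_subset[OF h]\<close>)
  qed
  finally show ?thesis .
qed

lemma measure_uniform_disk_radial:
  assumes R: "0 < R" and t: "0 \<le> t" "t \<le> R"
  shows "(\<integral>z. indicat_real {..t} (cmod z) \<partial>uniform_measure lborel (cball (0 :: complex) R)) = t\<^sup>2 / R\<^sup>2"
proof -
  have "((\<lambda>d. 2 * d / R\<^sup>2) has_integral (t\<^sup>2 / R\<^sup>2 - 0\<^sup>2 / R\<^sup>2)) {0..t}"
    using t R by (intro fundamental_theorem_of_calculus)
      (auto intro!: derivative_eq_intros simp: has_real_derivative_iff_has_vector_derivative[symmetric] field_simps eval_nat_numeral)
  then have "integral {0..t} (\<lambda>d. 1 * (2 * d / R\<^sup>2)) = t\<^sup>2 / R\<^sup>2"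
    by (intro integral_unique) simp
  then show ?thesis
    using integral_uniform_disk_radial[OF R t continuous_on_const, of 1]
    by (simp only: mult_1_right)
qed

section \<open>Measurability of the state and a strong law with state feedback\<close>

abbreviation slot_space :: "slot_input measure" where
  "slot_space \<equiv> count_space UNIV \<Otimes>\<^sub>M count_space UNIV \<Otimes>\<^sub>M count_space UNIV \<Otimes>\<^sub>M count_space UNIV \<Otimes>\<^sub>M borel \<Otimes>\<^sub>M borel"

abbreviation state_space :: "(nat \<times> real) measure" where
  "state_space \<equiv> count_space UNIV \<Otimes>\<^sub>M borel"

lemma sets_slot_dist:
  "sets alpha = sets borel \<Longrightarrow> sets (slot_dist N pc pu F R alpha) = sets slot_space"
  unfolding slot_dist_def by (intro sets_pair_measure_cong) auto

lemma measurable_eetb_step: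
  assumes [measurable]: "Eu \<in> borel_measurable borel"
  shows "(\<lambda>p. eetb_step C Ep Eu dt (fst p) (snd p)) \<in> measurable (state_space \<Otimes>\<^sub>M slot_space) state_space"
proof -
  \<comment> \<open>With the cache level fixed to a constant \<open>n\<close> the step is built from
    standard measurable operations; countability of the levels glues these pieces together.\<close>
  have "(\<lambda>p. eetb_step C Ep Eu dt (n, snd (fst p)) (snd p)) \<in> measurable (state_space \<Otimes>\<^sub>M slot_space) state_space" for n
    unfolding eetb_step_def eetb_push_def eetb_unicast_def case_prod_unfold Let_def fst_conv snd_conv
    by measurable
  then have "(\<lambda>p. eetb_step C Ep Eu dt (fst (fst p), snd (fst p)) (snd p)) \<in> measurable (state_space \<Otimes>\<^sub>M slot_space) state_space"
    by (rule measurable_compose_countable) measurable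
  then show ?thesis by simp
qed

text \<open>Measurability with respect to finitely many past inputs is what allows independence from
  the current input to be applied.\<close>

lemma measurable_eetb_state:
  assumes "Eu \<in> borel_measurable borel" and "k \<le> n"
  shows "(\<lambda>xs. eetb_state C Ep Eu dt s xs k) \<in> measurable (PiM {..<n} (\<lambda>_. slot_space)) state_space"
  using assms(2)
proof (induction k)
  case 0
  show ?case by (simp add: space_pair_measure)
next
  case (Suc k)
  then have [measurable]: "(\<lambda>xs. eetb_state C Ep Eu dt s xs k) \<in> measurable (PiM {..<n} (\<lambda>_. slot_space)) state_space"
    by simp
  have [measurable]: "(\<lambda>xs. xs k) \<in> measurable (PiM {..<n} (\<lambda>_. slot_space)) slot_space"
    using Suc.prems by (intro measurable_component_singleton) simp
  have "(\<lambda>xs. (eetb_state C Ep Eu dt s xs k, xs k)) \<in> measurable (PiM {..<n} (\<lambda>_. slot_space)) (state_space \<Otimes>\<^sub>M slot_space)"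
    by measurable
  from measurable_compose[OF this measurable_eetb_step[OF assms(1)]]
  show ?case by simp
qed

text \<open>The state in slot \<open>k\<close> is determined by earlier inputs, hence independent of
  input \<open>k\<close>. The centred terms are therefore bounded and pairwise orthogonal, whatever
  the long-run behaviour of the state.\<close>

lemma (in prob_space) cesaro_null_state_feedback:
  fixes Y :: "nat \<Rightarrow> 'a \<Rightarrow> slot_input" and H :: "nat \<times> real \<Rightarrow> real" and g :: "slot_input \<Rightarrow> real"
  assumes indep: "indep_vars (\<lambda>_. S) Y UNIV" and distr: "\<And>k. distr M S (Y k) = S"
    and sets_S: "sets S = sets slot_space"
    and Eu: "Eu \<in> borel_measurable borel"
    and H: "H \<in> borel_measurable state_space" "\<And>s. \<bar>H s\<bar> \<le> 1"
    and g: "g \<in> borel_measurable slot_space" "bounded (range g)" and mean: "(\<integral>x. g x \<partial>S) = \<mu>"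
  shows "AE \<omega> in M. cesaro_null (\<lambda>k. H (eetb_state C Ep Eu dt s (\<lambda>k. Y k \<omega>) k) * (g (Y k \<omega>) - \<mu>))"
proof -
  let ?st = "\<lambda>xs k. eetb_state C Ep Eu dt s xs k"
  have PiM_S: "measurable (PiM I (\<lambda>_. S)) N = measurable (PiM I (\<lambda>_. slot_space)) N" for I :: "nat set" and N :: "'c measure"
    by (intro measurable_cong_sets sets_PiM_cong sets_S refl)
  have rv: "random_variable S (Y k)" for k
    using indep by (auto simp: indep_vars_def)
  have [measurable]: "Y k \<in> measurable M slot_space" for k
    using rv[of k] measurable_cong_sets[OF refl sets_S, of M] by simp
  note [measurable] = H(1) g(1)
  have Hst: "(\<lambda>xs. H (?st xs k)) \<in> borel_measurable (PiM {..<n} (\<lambda>_. slot_space))" if "k \<le> n" for k n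
    by (rule measurable_compose[OF measurable_eetb_state[OF Eu that] H(1)])
  have st_restrict: "?st (\<lambda>i. Y i \<omega>) k = ?st (restrict (\<lambda>i. Y i \<omega>) {..<n}) k" if "k \<le> n" for \<omega> k n
    using that by (intro eetb_state_cong) auto
  have [measurable]: "(\<lambda>\<omega>. H (?st (\<lambda>i. Y i \<omega>) k)) \<in> borel_measurable M" for k
    unfolding st_restrict[OF order_refl]
    by (rule measurable_compose[OF _ Hst[OF order_refl]]) measurable
  obtain b where b: "\<And>x. \<bar>g x\<bar> \<le> b" using g(2) by (auto simp: bounded_iff)
  have b0: "0 \<le> b" using b[of undefined] by linarith
  have gb: "\<bar>g x - \<mu>\<bar> \<le> b + \<bar>\<mu>\<bar>" for x using b[of x] by linarith
  have mean0: "expectation (\<lambda>\<omega>. g (Y k \<omega>) - \<mu>) = 0" for k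
  proof -
    have "expectation (\<lambda>\<omega>. g (Y k \<omega>)) = (\<integral>x. g x \<partial>distr M S (Y k))"
      using rv g(1) by (subst integral_distr) (simp_all add: measurable_cong_sets[OF sets_S refl])
    also have "\<dots> = \<mu>" by (simp add: distr mean)
    finally have "expectation (\<lambda>\<omega>. g (Y k \<omega>)) = \<mu>" .
    moreover have "integrable M (\<lambda>\<omega>. g (Y k \<omega>))"
      by (rule integrable_const_bound[of _ b]) (auto simp: b)
    ultimately show ?thesis by (simp add: prob_space)
  qed
  show ?thesis
  proof (rule cesaro_null_orthogonal)
    show "(\<lambda>\<omega>. H (?st (\<lambda>k. Y k \<omega>) k) * (g (Y k \<omega>) - \<mu>)) \<in> borel_measurable M" for k
      by measurable
    show "\<bar>H (?st (\<lambda>k. Y k \<omega>) k) * (g (Y k \<omega>) - \<mu>)\<bar> \<le> 1 * (b + \<bar>\<mu>\<bar>)" for k \<omega>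
      unfolding abs_mult by (intro mult_mono H(2) gb) auto
    fix j k :: nat assume "j < k"
    \<comment> \<open>\<open>\<Phi>\<close> collects the factors of the product fixed before slot
      \<open>k\<close>, including the state at \<open>k\<close> itself; \<open>\<Psi>\<close> is the
      centred input of slot \<open>k\<close>, whose mean is zero.\<close>
    define \<Phi> where "\<Phi> xs = H (?st xs j) * (g (xs j) - \<mu>) * H (?st xs k)" for xs
    define \<Psi> where "\<Psi> xs = g (xs k) - \<mu>" for xs
    have proj: "(\<lambda>xs. xs i) \<in> measurable (PiM I (\<lambda>_. slot_space)) slot_space" if "i \<in> I" for i and I :: "nat set"
      using that by (intro measurable_component_singleton) simp
    have [measurable]: "(\<lambda>xs. g (xs j)) \<in> borel_measurable (PiM {..<k} (\<lambda>_. slot_space))"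
      by (rule measurable_compose[OF proj g(1)]) (use \<open>j < k\<close> in simp)
    note [measurable] = Hst[OF less_imp_le[OF \<open>j < k\<close>]] Hst[OF order_refl[of k]]
    have \<Phi>: "\<Phi> \<in> borel_measurable (PiM {..<k} (\<lambda>_. S))"
      unfolding PiM_S \<Phi>_def[abs_def] by measurable
    have [measurable]: "(\<lambda>xs. g (xs k)) \<in> borel_measurable (PiM {k} (\<lambda>_. slot_space))"
      by (rule measurable_compose[OF proj g(1)]) simp
    have \<Psi>: "\<Psi> \<in> borel_measurable (PiM {k} (\<lambda>_. S))"
      unfolding PiM_S \<Psi>_def[abs_def] by measurable
    have \<Phi>b: "\<bar>\<Phi> xs\<bar> \<le> 1 * (b + \<bar>\<mu>\<bar>) * 1" for xs
      unfolding \<Phi>_def abs_mult by (intro mult_mono H(2) gb) (use b0 in auto)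
    have "indep_var (PiM {..<k} (\<lambda>_. S)) (\<lambda>\<omega>. restrict (\<lambda>i. Y i \<omega>) {..<k}) (PiM {k} (\<lambda>_. S)) (\<lambda>\<omega>. restrict (\<lambda>i. Y i \<omega>) {k})"
      by (rule indep_var_restrict[OF indep]) auto
    from indep_var_compose[OF this \<Phi> \<Psi>]
    have ind: "indep_var borel (\<lambda>\<omega>. \<Phi> (restrict (\<lambda>i. Y i \<omega>) {..<k})) borel (\<lambda>\<omega>. g (Y k \<omega>) - \<mu>)"
      by (simp add: comp_def \<Psi>_def)
    have eq: "\<Phi> (restrict (\<lambda>i. Y i \<omega>) {..<k}) = H (?st (\<lambda>i. Y i \<omega>) j) * (g (Y j \<omega>) - \<mu>) * H (?st (\<lambda>i. Y i \<omega>) k)" for \<omega>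
      using st_restrict[of j k \<omega>] st_restrict[of k k \<omega>] \<open>j < k\<close> by (simp add: \<Phi>_def)
    have int_\<Phi>: "integrable M (\<lambda>\<omega>. \<Phi> (restrict (\<lambda>i. Y i \<omega>) {..<k}))"
      unfolding eq using \<Phi>b[of "restrict (\<lambda>i. Y i _) {..<k}", unfolded eq]
      by (intro integrable_const_bound[of _ "1 * (b + \<bar>\<mu>\<bar>) * 1"]) auto
    have int_\<Psi>: "integrable M (\<lambda>\<omega>. g (Y k \<omega>) - \<mu>)"
      by (rule integrable_const_bound[of _ "b + \<bar>\<mu>\<bar>"]) (auto simp: gb)
    have "expectation (\<lambda>\<omega>. \<Phi> (restrict (\<lambda>i. Y i \<omega>) {..<k}) * (g (Y k \<omega>) - \<mu>)) = 0"
      using indep_var_lebesgue_integral[OF ind int_\<Phi> int_\<Psi>] mean0 by simp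
    then show "expectation (\<lambda>\<omega>. H (?st (\<lambda>k. Y k \<omega>) j) * (g (Y j \<omega>) - \<mu>) * (H (?st (\<lambda>k. Y k \<omega>) k) * (g (Y k \<omega>) - \<mu>))) = 0"
      unfolding eq by (simp add: mult_ac)
  qed
qed

text \<open>Stated for a product with one factor per component, so that every required mean follows
  by inserting indicators and the constant 1. The proof splits off one factor at a time.\<close>

lemma integral_slot_dist:
  fixes f1 :: "bool \<Rightarrow> real" and f2 :: "nat \<Rightarrow> real" and f3 :: "bool \<Rightarrow> real" and f4 :: "nat \<Rightarrow> real"
    and f5 :: "complex \<Rightarrow> real" and f6 :: "real \<Rightarrow> real"
  assumes "prob_space alpha" and sets_alpha: "sets alpha = sets borel" and "0 < R"
    and meas: "f5 \<in> borel_measurable borel" "f6 \<in> borel_measurable borel"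
    and bdd: "bounded (range f1)" "bounded (range f2)" "bounded (range f3)" "bounded (range f4)" "bounded (range f5)" "bounded (range f6)"
  shows "(\<integral>x. f1 (fst x) * (f2 (fst (snd x)) * (f3 (fst (snd (snd x))) * (f4 (fst (snd (snd (snd x)))) *
      (f5 (fst (snd (snd (snd (snd x))))) * f6 (snd (snd (snd (snd (snd x)))))))))
      \<partial>slot_dist N pc pu F R alpha) =
    (\<integral>x. f1 x \<partial>bernoulli_pmf pc) * ((\<integral>x. f2 x \<partial>pmf_of_set {1..N}) * ((\<integral>x. f3 x \<partial>bernoulli_pmf pu) *
      ((\<integral>x. f4 x \<partial>F) * ((\<integral>x. f5 x \<partial>uniform_measure lborel (cball 0 R)) * (\<integral>x. f6 x \<partial>alpha)))))"
proof -
  interpret alpha: prob_space alpha by fact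
  interpret U: prob_space "uniform_measure lborel (cball (0::complex) R)"
    by (rule prob_space_uniform_disk) fact
  note P = prob_space_measure_pmf U.prob_space_axioms alpha.prob_space_axioms
  have pair: "prob_space (A \<Otimes>\<^sub>M B)" if "prob_space A" "prob_space B" for A :: "'x measure" and B :: "'y measure"
  proof -
    interpret A: prob_space A by fact
    interpret B: prob_space B by fact
    interpret pair_prob_space A B ..
    show ?thesis by (rule P.prob_space_axioms)
  qed
  have m6[measurable]: "f6 \<in> borel_measurable alpha"
    by (subst measurable_cong_sets[OF sets_alpha refl]) (rule meas(2))
  note [measurable] = meas(1)
  note bp = bounded_range_pair_mult bdd
  show ?thesis
    unfolding slot_dist_def
    apply (subst prob_space_integral_pair_mult[where f = f1 and g = "\<lambda>y. f2 (fst y) * (f3 (fst (snd y)) * (f4 (fst (snd (snd y))) * (f5 (fst (snd (snd (snd y)))) * f6 (snd (snd (snd (snd y)))))))"])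
    subgoal by (intro pair P)
    subgoal by (intro pair P)
    subgoal by simp
    subgoal by measurable
    subgoal by (intro bdd)
    subgoal by (intro bp)
    apply (subst prob_space_integral_pair_mult[where f = f2 and g = "\<lambda>y. f3 (fst y) * (f4 (fst (snd y)) * (f5 (fst (snd (snd y))) * f6 (snd (snd (snd y)))))"])
    subgoal by (intro pair P)
    subgoal by (intro pair P)
    subgoal by simp
    subgoal by measurable
    subgoal by (intro bdd)
    subgoal by (intro bp)
    apply (subst prob_space_integral_pair_mult[where f = f3 and g = "\<lambda>y. f4 (fst y) * (f5 (fst (snd y)) * f6 (snd (snd y)))"])
    subgoal by (intro pair P)
    subgoal by (intro pair P)
    subgoal by simp
    subgoal by measurable
    subgoal by (intro bdd)
    subgoal by (intro bp)
    apply (subst prob_space_integral_pair_mult[where f = f4 and g = "\<lambda>y. f5 (fst y) * f6 (snd y)"])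
    subgoal by (intro pair P)
    subgoal by (intro pair P)
    subgoal by simp
    subgoal by measurable
    subgoal by (intro bdd)
    subgoal by (intro bp)
    apply (subst prob_space_integral_pair_mult[where f = f5 and g = f6])
    subgoal by (intro pair P)
    subgoal by (intro pair P)
    subgoal by simp
    subgoal by measurable
    subgoal by (intro bdd)
    subgoal by (intro bp)
    apply (rule refl)
    done
qed

section \<open>Almost sure blocking frequency\<close>

lemma measurable_of_bool[measurable (raw)]:
  "Measurable.pred M P \<Longrightarrow> (\<lambda>x. of_bool (P x) :: real) \<in> borel_measurable M"
  unfolding of_bool_def by measurable

lemma bounded_rangeI:
  fixes f :: "'a \<Rightarrow> real"
  shows "(\<And>x. \<bar>f x\<bar> \<le> b) \<Longrightarrow> bounded (range f)"
  unfolding bounded_iff by auto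

lemma bounded_range_of_bool: "bounded (range (\<lambda>x. of_bool (P x) :: real))"
  by (auto simp: bounded_iff intro!: exI[of _ 1])

lemma bounded_range_const: "bounded (range (\<lambda>x. c :: real))"
  by (auto simp: bounded_iff)

context eetb_params
begin

lemma Eu_measurable: "Eu \<in> borel_measurable borel"
  using Eu_cont by (rule borel_measurable_continuous_onI)

lemma bounded_Eu_near: "bounded (range (\<lambda>z. of_bool (cmod z \<le> dt) * Eu (cmod z)))"
proof -
  have "\<bar>of_bool (cmod z \<le> dt) * Eu (cmod z)\<bar> \<le> Eu dt" for z
    using Eu_le_iff[of "cmod z" dt] Eu_nonneg[of "cmod z"] Eu_nonneg[of dt] dt
    by (cases "cmod z \<le> dt") auto
  then show ?thesis by (rule bounded_rangeI)
qed

lemma integral_near: 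
  "(\<integral>z. of_bool (cmod z \<le> dt) * Eu (cmod z) \<partial>uniform_measure lborel (cball (0 :: complex) R)) = part_unicast R Eu dt"
  using integral_uniform_disk_radial[OF R _ _ Eu_cont, of dt] dt
  by (simp add: part_unicast_def indicator_def of_bool_def)

lemma integral_far:
  assumes "0 \<le> t" "t \<le> R"
  shows "(\<integral>z. of_bool (t < cmod z) \<partial>uniform_measure lborel (cball (0 :: complex) R)) = 1 - t\<^sup>2 / R\<^sup>2"
proof -
  interpret U: prob_space "uniform_measure lborel (cball (0::complex) R)"
    by (rule prob_space_uniform_disk[OF R])
  have "integrable (uniform_measure lborel (cball (0 :: complex) R)) (\<lambda>z. indicat_real {..t} (cmod z))"
    by (rule U.integrable_const_bound[of _ 1]) (auto simp: indicator_def)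
  then have "(\<integral>z. 1 - indicat_real {..t} (cmod z) \<partial>uniform_measure lborel (cball (0 :: complex) R)) = 1 - t\<^sup>2 / R\<^sup>2"
    using measure_uniform_disk_radial[OF R assms] U.prob_space by simp
  moreover have "1 - indicat_real {..t} (cmod z) = of_bool (t < cmod z)" for z
    by (auto simp: indicator_def)
  ultimately show ?thesis by simp
qed

lemma integral_close:
  assumes "0 \<le> t" "t \<le> R"
  shows "(\<integral>z. of_bool (cmod z \<le> t) \<partial>uniform_measure lborel (cball (0 :: complex) R)) = t\<^sup>2 / R\<^sup>2"
  using measure_uniform_disk_radial[OF R assms] by (simp add: indicator_def of_bool_def)

text \<open>The radius bound is part of the conclusion because \<open>theorem2\<close> applies this
  lemma to an extension of its \<open>Eu\<close> and must return to the original function along the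
  same paths.\<close>

lemma blocking_probability:
  fixes M :: "'w measure" and Y :: "nat \<Rightarrow> 'w \<Rightarrow> slot_input"
    and alpha :: "real measure" and F :: "nat pmf" and pu Abar E0 :: real and C0 :: nat
  defines "S \<equiv> slot_dist N pc pu F R alpha"
    and "\<psi> \<equiv> pc * real C / (real N + pc)"
    and "\<rho> \<equiv> pu * measure_pmf.prob F {C<..}"
  assumes "prob_space M" and pu: "0 \<le> pu" "pu \<le> 1"
    and alpha: "prob_space alpha" "sets alpha = sets borel" "AE a in alpha. 0 \<le> a" "integrable alpha (\<lambda>a. a)"
    and Abar: "Abar = (\<integral>a. a \<partial>alpha)"
    and indep: "prob_space.indep_vars M (\<lambda>_. S) Y UNIV" and distr: "\<And>k. distr M S (Y k) = S"
    and budget: "\<psi> * Ep + (1 - \<psi>) * (\<rho> * part_unicast R Eu dt) \<le> Abar"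
    and C0: "C0 \<le> N"
  shows "AE \<omega> in M. (\<forall>k. radius (Y k \<omega>) \<le> R) \<and>
    (\<lambda>K. real (card {k. k < K \<and> eetb_blocked C Ep Eu dt (C0, E0) (\<lambda>k. Y k \<omega>) k}) / real K)
      \<longlonglongrightarrow> \<psi> * \<rho> + (1 - \<psi>) * (\<rho> * (1 - dt\<^sup>2 / R\<^sup>2))"
proof -
  interpret M: prob_space M by fact
  interpret alpha: prob_space alpha by fact
  interpret U: prob_space "uniform_measure lborel (cball (0::complex) R)"
    by (rule prob_space_uniform_disk[OF R])
  note [measurable] = Eu_measurable
  note sets_S = sets_slot_dist[OF alpha(2), of N pc pu F R, folded S_def]
  note bdd = bounded_range_of_bool bounded_range_const bounded_Eu_near
  note ev = integral_slot_dist[OF alpha(1,2) R, where N = N and pc = pc and pu = pu and F = F, folded S_def]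
  have feedback: "AE \<omega> in M. cesaro_null (\<lambda>k. H (eetb_state C Ep Eu dt (C0, E0) (\<lambda>k. Y k \<omega>) k) * (g (Y k \<omega>) - \<mu>))"
    if "H \<in> borel_measurable state_space" "\<And>s. \<bar>H s\<bar> \<le> 1" "g \<in> borel_measurable slot_space" "bounded (range g)" "(\<integral>x. g x \<partial>S) = \<mu>"
    for H and g :: "slot_input \<Rightarrow> real" and \<mu>
    by (rule M.cesaro_null_state_feedback[OF indep distr sets_S Eu_measurable that])
  have Y[measurable]: "Y k \<in> measurable M S" for k
    using indep by (auto simp: M.indep_vars_def)
  have S: "prob_space S"
    using M.prob_space_distr[OF Y[of 0]] by (simp add: distr)
  \<comment> \<open>A nonnegative function of mean zero vanishes in all slots at once. This discards
    removed rank 0, radius 0, positions outside the disk and negative harvests.\<close>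
  have null: "AE \<omega> in M. \<forall>k. g (Y k \<omega>) = 0"
    if g: "g \<in> borel_measurable slot_space" "bounded (range g)" "\<And>x. 0 \<le> g x" "(\<integral>x. g x \<partial>S) = 0" for g :: "slot_input \<Rightarrow> real"
  proof -
    interpret S: prob_space S by fact
    have meas[measurable]: "g \<in> borel_measurable S"
      by (subst measurable_cong_sets[OF sets_S refl]) (rule g(1))
    obtain b where "\<And>x. \<bar>g x\<bar> \<le> b" using g(2) by (auto simp: bounded_iff)
    then have "integrable S g"
      by (intro S.integrable_const_bound[of _ b]) auto
    then have "AE x in S. g x = 0"
      using integral_nonneg_eq_0_iff_AE[of S g] g(3,4) by simp
    then have "AE x in distr M S (Y k). g x = 0" for k
      by (simp only: distr)
    then have "AE \<omega> in M. g (Y k \<omega>) = 0" for k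
      by (rule AE_distrD[OF Y])
    then show ?thesis by (simp add: AE_all_countable)
  qed
  have ball_F: "(\<integral>i. of_bool (C < i) \<partial>F) = measure_pmf.prob F {C<..}"
  proof -
    have "(\<integral>i. of_bool (C < i) \<partial>F) = (\<integral>i. indicat_real {C<..} i \<partial>F)"
      by (simp add: indicator_def of_bool_def)
    then show ?thesis by simp
  qed
  have rank_mean: "(\<integral>r. of_bool (r \<le> j) \<partial>pmf_of_set {1..N}) = real j / real N" if "j \<le> N" for j
  proof -
    have "{1..N} \<inter> {r. r \<le> j} = {1..j}" using that by auto
    then show ?thesis using N by (simp add: integral_pmf_of_set)
  qed
  have rank_zero: "(\<integral>r. of_bool (r < 1) \<partial>pmf_of_set {1..N}) = (0 :: real)"
    by (subst integral_pmf_of_set) (use N in auto)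
  have "U.prob UNIV = 1" using U.prob_space by simp
  note const = measure_pmf.prob_space this alpha.prob_space
  have m_removal: "(\<integral>x. of_bool (removal x \<and> removed_rank x \<le> j) \<partial>S) = pc * real j / real N" if "j \<le> N" for j
    using ev[where ?f1.0 = of_bool and ?f2.0 = "\<lambda>r. of_bool (r \<le> j)" and ?f3.0 = "\<lambda>_. 1" and ?f4.0 = "\<lambda>_. 1"
      and ?f5.0 = "\<lambda>_. 1" and ?f6.0 = "\<lambda>_. 1", OF borel_measurable_const borel_measurable_const bdd(1,1,2,2,2,2)] pc
    by (simp add: rank_mean[OF that] of_bool_conj const del: One_nat_def)
  have m_miss: "(\<integral>x. of_bool (request x \<and> C < requested_rank x) \<partial>S) = \<rho>"
    using ev[where ?f1.0 = "\<lambda>_. 1" and ?f2.0 = "\<lambda>_. 1" and ?f3.0 = of_bool and ?f4.0 = "\<lambda>i. of_bool (C < i)"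
      and ?f5.0 = "\<lambda>_. 1" and ?f6.0 = "\<lambda>_. 1", OF borel_measurable_const borel_measurable_const bdd(2,2,1,1,2,2)] pu
    by (simp add: ball_F of_bool_conj const \<rho>_def)
  have m_near: "(\<integral>x. of_bool (request x \<and> C < requested_rank x \<and> radius x \<le> dt) * Eu (radius x) \<partial>S) = \<rho> * part_unicast R Eu dt"
    using ev[where ?f1.0 = "\<lambda>_. 1" and ?f2.0 = "\<lambda>_. 1" and ?f3.0 = of_bool and ?f4.0 = "\<lambda>i. of_bool (C < i)"
      and ?f5.0 = "\<lambda>z. of_bool (cmod z \<le> dt) * Eu (cmod z)" and ?f6.0 = "\<lambda>_. 1", OF _ borel_measurable_const bdd(2,2,1,1,3,2)] pu
    by (simp add: ball_F of_bool_conj const \<rho>_def integral_near mult.assoc)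
  have m_far: "(\<integral>x. of_bool (request x \<and> C < requested_rank x \<and> dt < radius x) \<partial>S) = \<rho> * (1 - dt\<^sup>2 / R\<^sup>2)"
    using ev[where ?f1.0 = "\<lambda>_. 1" and ?f2.0 = "\<lambda>_. 1" and ?f3.0 = of_bool and ?f4.0 = "\<lambda>i. of_bool (C < i)"
      and ?f5.0 = "\<lambda>z. of_bool (dt < cmod z)" and ?f6.0 = "\<lambda>_. 1", OF _ borel_measurable_const bdd(2,2,1,1,1,2)] pu dt
    by (simp add: ball_F of_bool_conj const \<rho>_def integral_far mult.assoc)
  have m_close: "(\<integral>x. of_bool (radius x \<le> t) \<partial>S) = t\<^sup>2 / R\<^sup>2" if "0 \<le> t" "t \<le> R" for t
    using ev[where ?f1.0 = "\<lambda>_. 1" and ?f2.0 = "\<lambda>_. 1" and ?f3.0 = "\<lambda>_. 1" and ?f4.0 = "\<lambda>_. 1"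
      and ?f5.0 = "\<lambda>z. of_bool (cmod z \<le> t)" and ?f6.0 = "\<lambda>_. 1", OF _ borel_measurable_const bdd(2,2,2,2,1,2)]
    by (simp add: const integral_close[OF that])
  have m_outside: "(\<integral>x. of_bool (R < radius x) \<partial>S) = (0 :: real)"
    using ev[where ?f1.0 = "\<lambda>_. 1" and ?f2.0 = "\<lambda>_. 1" and ?f3.0 = "\<lambda>_. 1" and ?f4.0 = "\<lambda>_. 1"
      and ?f5.0 = "\<lambda>z. of_bool (R < cmod z)" and ?f6.0 = "\<lambda>_. 1", OF _ borel_measurable_const bdd(2,2,2,2,1,2)] R
    by (simp add: const integral_far)
  have m_rank: "(\<integral>x. of_bool (removed_rank x < 1) \<partial>S) = (0 :: real)"
    using ev[where ?f1.0 = "\<lambda>_. 1" and ?f2.0 = "\<lambda>r. of_bool (r < 1)" and ?f3.0 = "\<lambda>_. 1" and ?f4.0 = "\<lambda>_. 1"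
      and ?f5.0 = "\<lambda>_. 1" and ?f6.0 = "\<lambda>_. 1", OF borel_measurable_const borel_measurable_const bdd(2,1,2,2,2,2)]
    by (simp add: const rank_zero del: One_nat_def less_one)
  have m_harvest: "(\<integral>x. h (harvest x) \<partial>S) = (\<integral>a. h a \<partial>alpha)" if "h \<in> borel_measurable borel" "bounded (range h)" for h :: "real \<Rightarrow> real"
    using ev[where ?f1.0 = "\<lambda>_. 1" and ?f2.0 = "\<lambda>_. 1" and ?f3.0 = "\<lambda>_. 1" and ?f4.0 = "\<lambda>_. 1"
      and ?f5.0 = "\<lambda>_. 1" and ?f6.0 = h, OF borel_measurable_const that(1) bdd(2,2,2,2,2) that(2)]
    by (simp add: const)
  have m_debt: "(\<integral>x. of_bool (harvest x < 0) \<partial>S) = (0 :: real)"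
    unfolding m_harvest[of "\<lambda>a. of_bool (a < 0)", OF _ bounded_range_of_bool, simplified]
    using alpha(3) by (intro integral_eq_zero_AE) auto
  \<comment> \<open>Only a lower bound on the harvested energy is needed, so truncation reduces the integrable case to the bounded one.\<close>
  define h where "h n a = max 0 (min a (real n))" for n and a :: real
  have h_meas: "h n \<in> borel_measurable borel" for n
    unfolding h_def[abs_def] by measurable
  have h_bdd: "bounded (range (h n))" for n
    by (auto simp: bounded_iff h_def intro!: exI[of _ "real n"])
  have h_lim: "(\<lambda>n. \<integral>a. h n a \<partial>alpha) \<longlonglongrightarrow> Abar"
    unfolding Abar
  proof (rule integral_dominated_convergence[where w = "\<lambda>a. \<bar>a\<bar>"])
    show "(\<lambda>a. a) \<in> borel_measurable alpha" by (rule borel_measurable_integrable[OF alpha(4)])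
    show "h n \<in> borel_measurable alpha" for n
      by (subst measurable_cong_sets[OF alpha(2) refl]) (rule h_meas)
    show "integrable alpha (\<lambda>a. \<bar>a\<bar>)" using alpha(4) by simp
    show "AE a in alpha. (\<lambda>n. h n a) \<longlonglongrightarrow> a"
      using alpha(3)
    proof eventually_elim
      case (elim a)
      obtain m where m: "a \<le> real m" using real_arch_simple by blast
      have "\<forall>\<^sub>F n in sequentially. h n a = a"
        using eventually_ge_at_top[of m] by eventually_elim (use m elim in \<open>auto simp: h_def\<close>)
      then show ?case by (rule tendsto_eventually)
    qed
    show "AE a in alpha. norm (h n a) \<le> \<bar>a\<bar>" for n
      by (auto simp: h_def)
  qed
  have "AE \<omega> in M. \<forall>j\<in>{..N}. cesaro_null (\<lambda>k. of_bool (fst (eetb_state C Ep Eu dt (C0, E0) (\<lambda>k. Y k \<omega>) k) = j) *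
      (of_bool (removal (Y k \<omega>) \<and> removed_rank (Y k \<omega>) \<le> j) - pc * real j / real N))"
    by (intro AE_finite_allI feedback[of "\<lambda>s. of_bool (fst s = _)"]) (auto intro!: m_removal bdd)
  moreover have "AE \<omega> in M. cesaro_null (\<lambda>k. of_bool (Ep \<le> snd (eetb_state C Ep Eu dt (C0, E0) (\<lambda>k. Y k \<omega>) k) \<and> fst (eetb_state C Ep Eu dt (C0, E0) (\<lambda>k. Y k \<omega>) k) + 1 = C) *
        (of_bool (removal (Y k \<omega>) \<and> removed_rank (Y k \<omega>) \<le> C - 1) - pc * real (C - 1) / real N))"
    by (rule feedback[of "\<lambda>s. of_bool (Ep \<le> snd s \<and> fst s + 1 = C)"]) (use C_le in \<open>auto intro!: m_removal bdd\<close>)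
  moreover have "AE \<omega> in M. cesaro_null (\<lambda>k. of_bool (fst (eetb_state C Ep Eu dt (C0, E0) (\<lambda>k. Y k \<omega>) k) = C) *
        (of_bool (request (Y k \<omega>) \<and> C < requested_rank (Y k \<omega>) \<and> radius (Y k \<omega>) \<le> dt) * Eu (radius (Y k \<omega>)) - \<rho> * part_unicast R Eu dt))"
  proof (rule feedback[of "\<lambda>s. of_bool (fst s = C)"])
    obtain b where b: "\<bar>of_bool (cmod z \<le> dt) * Eu (cmod z)\<bar> \<le> b" for z
      using bounded_Eu_near by (auto simp: bounded_iff)
    have "\<bar>of_bool (request x \<and> C < requested_rank x \<and> radius x \<le> dt) * Eu (radius x)\<bar> \<le> b" for x
      using b[of "fst (snd (snd (snd (snd x))))"] by (auto split: if_splits)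
    then show "bounded (range (\<lambda>x. of_bool (request x \<and> C < requested_rank x \<and> radius x \<le> dt) * Eu (radius x)))"
      by (rule bounded_rangeI)
  qed (auto intro!: m_near)
  moreover have "AE \<omega> in M. cesaro_null (\<lambda>k. of_bool (Ep \<le> snd (eetb_state C Ep Eu dt (C0, E0) (\<lambda>k. Y k \<omega>) k) \<and> fst (eetb_state C Ep Eu dt (C0, E0) (\<lambda>k. Y k \<omega>) k) + 1 = C) *
        (of_bool (request (Y k \<omega>) \<and> C < requested_rank (Y k \<omega>)) - \<rho>))"
    by (rule feedback[of "\<lambda>s. of_bool (Ep \<le> snd s \<and> fst s + 1 = C)"]) (auto intro!: m_miss bdd)
  moreover have "AE \<omega> in M. cesaro_null (\<lambda>k. of_bool (fst (eetb_state C Ep Eu dt (C0, E0) (\<lambda>k. Y k \<omega>) k) = C) *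
        (of_bool (request (Y k \<omega>) \<and> C < requested_rank (Y k \<omega>) \<and> dt < radius (Y k \<omega>)) - \<rho> * (1 - dt\<^sup>2 / R\<^sup>2)))"
    by (rule feedback[of "\<lambda>s. of_bool (fst s = C)"]) (auto intro!: m_far bdd)
  moreover have "AE \<omega> in M. \<forall>n. cesaro_null (\<lambda>k. of_bool (radius (Y k \<omega>) \<le> R / real (Suc n)) - (1 / real (Suc n))\<^sup>2)"
    unfolding AE_all_countable
  proof
    fix n
    have "(\<integral>x. of_bool (radius x \<le> R / real (Suc n)) \<partial>S) = (1 / real (Suc n))\<^sup>2"
      using R by (subst m_close) (auto simp: power_divide divide_le_eq)
    \<comment> \<open>With the constant state function 1 the feedback law is the ordinary strong law
      for bounded variables.\<close>
    from feedback[of "\<lambda>_. 1", OF _ _ _ bounded_range_of_bool this]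
    show "AE \<omega> in M. cesaro_null (\<lambda>k. of_bool (radius (Y k \<omega>) \<le> R / real (Suc n)) - (1 / real (Suc n))\<^sup>2)"
      by (simp del: of_nat_Suc)
  qed
  moreover have "AE \<omega> in M. \<forall>n. cesaro_null (\<lambda>k. h n (harvest (Y k \<omega>)) - (\<integral>a. h n a \<partial>alpha))"
    unfolding AE_all_countable
  proof
    fix n
    have "bounded (range (\<lambda>x. h n (harvest x)))"
      by (rule bounded_subset[OF h_bdd[of n]]) auto
    from feedback[of "\<lambda>_. 1", OF _ _ _ this m_harvest[OF h_meas h_bdd]]
    show "AE \<omega> in M. cesaro_null (\<lambda>k. h n (harvest (Y k \<omega>)) - (\<integral>a. h n a \<partial>alpha))"
      using h_meas[of n] by simp
  qed
  moreover have "AE \<omega> in M. \<forall>k. of_bool (removed_rank (Y k \<omega>) < 1) = (0 :: real)"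
    by (rule null[of "\<lambda>x. of_bool (removed_rank x < 1)"]) (use m_rank in \<open>simp_all add: bdd del: One_nat_def less_one\<close>)
  moreover have "AE \<omega> in M. \<forall>k. of_bool (R < radius (Y k \<omega>)) = (0 :: real)"
    by (rule null[of "\<lambda>x. of_bool (R < radius x)"]) (use m_outside in \<open>simp_all add: bdd\<close>)
  moreover have "AE \<omega> in M. \<forall>k. of_bool (radius (Y k \<omega>) \<le> 0) = (0 :: real)"
    by (rule null[of "\<lambda>x. of_bool (radius x \<le> 0)"]) (use m_close[of 0] R in \<open>simp_all add: bdd del: norm_le_zero_iff\<close>)
  moreover have "AE \<omega> in M. \<forall>k. of_bool (harvest (Y k \<omega>) < 0) = (0 :: real)"
    by (rule null[of "\<lambda>x. of_bool (harvest x < 0)"]) (use m_debt in \<open>simp_all add: bdd\<close>)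
  ultimately show ?thesis
  proof eventually_elim
    case (elim \<omega>)
    have r: "1 \<le> removed_rank (Y k \<omega>)" "0 < radius (Y k \<omega>)" "radius (Y k \<omega>) \<le> R" "0 \<le> harvest (Y k \<omega>)" for k
      using elim(8-11)[rule_format, of k] by (simp_all only: of_bool_eq_0_iff not_less not_le)
    have part_nonneg: "0 \<le> part_unicast R Eu dt"
      unfolding part_unicast_def
    proof (rule integral_nonneg)
      show "(\<lambda>d. Eu d * (2 * d / R\<^sup>2)) integrable_on {0..dt}"
        using R by (intro integrable_continuous_interval) (auto intro!: continuous_intros intro: continuous_on_subset[OF Eu_cont])
      show "0 \<le> Eu d * (2 * d / R\<^sup>2)" if "d \<in> {0..dt}" for d
        using that dt Eu_nonneg[of d] by simp
    qed
    interpret eetb_path N C pc R Ep dt Eu "\<lambda>k. Y k \<omega>" "(C0, E0)" Abar "\<rho> * part_unicast R Eu dt" \<rho> "\<rho> * (1 - dt\<^sup>2 / R\<^sup>2)"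
    proof
      show "0 \<le> \<rho> * part_unicast R Eu dt" using part_nonneg pu by (simp add: \<rho>_def)
      show "pc * real C / (real N + pc) * Ep + (1 - pc * real C / (real N + pc)) * (\<rho> * part_unicast R Eu dt) \<le> Abar"
        using budget by (simp only: \<psi>_def)
      fix \<epsilon> :: real assume "0 < \<epsilon>"
      then have "\<forall>\<^sub>F n in sequentially. Abar - \<epsilon> < (\<integral>a. h n a \<partial>alpha)"
        by (intro order_tendstoD(1)[OF h_lim]) simp
      then obtain n where n: "Abar - \<epsilon> < (\<integral>a. h n a \<partial>alpha)"
        by (metis eventually_happens trivial_limit_sequentially)
      have "h n (harvest (Y k \<omega>)) \<le> harvest (Y k \<omega>)" for k
        using r(4)[of k] by (simp add: h_def)
      then have "Abar - \<epsilon> + (h n (harvest (Y k \<omega>)) - (\<integral>a. h n a \<partial>alpha)) \<le> harvest (Y k \<omega>)" for k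
        using n by (smt (verit))
      then show "\<exists>Z. cesaro_null Z \<and> (\<forall>k. Abar - \<epsilon> + Z k \<le> harvest (Y k \<omega>))"
        using elim(7) by blast
    qed (use elim(1-6) r C0 in auto)
    show ?case
      using blocked_frequency r(3) unfolding \<phi>_def \<psi>_def by blast
  qed
qed

end

section \<open>The Zipf tail and the final formula\<close>

lemma zipf_pop_sum: "1 \<le> N \<Longrightarrow> (\<Sum>i=1..N. zipf_pop N v i) = 1"
proof -
  assume "1 \<le> N"
  then have "0 < (\<Sum>j=1..N. real j powr (- v))"
    by (intro sum_pos) auto
  then show ?thesis by (simp add: zipf_pop_def sum_divide_distrib[symmetric])
qed

text \<open>\<open>F\<close> is prescribed only on \<open>{1..N}\<close>, but these weights already
  sum to 1. Rank 0 thus has no mass, and the tail is the complement of the first \<open>C\<close>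
  weights.\<close>

lemma zipf_pmf_above:
  assumes F: "\<forall>i\<in>{1..N}. pmf F i = zipf_pop N v i" and "1 \<le> N" and "C \<le> N"
  shows "measure_pmf.prob F {C<..} = 1 - (\<Sum>i=1..C. zipf_pop N v i)"
proof -
  have sum: "measure_pmf.prob F {1..n} = (\<Sum>i=1..n. zipf_pop N v i)" if "n \<le> N" for n
    using that F by (simp add: measure_measure_pmf_finite)
  then have "measure_pmf.prob F {1..N} = 1" using zipf_pop_sum[OF \<open>1 \<le> N\<close>] by simp
  moreover have "measure_pmf.prob F {0} + measure_pmf.prob F {1..N} = measure_pmf.prob F ({0} \<union> {1..N})"
    by (rule measure_pmf.finite_measure_Union[symmetric]) auto
  ultimately have 0: "measure_pmf.prob F {0} = 0"
    using measure_pmf.prob_le_1[of F "{0} \<union> {1..N}"] measure_nonneg[of F "{0}"] by linarith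
  have "{..C} = {0} \<union> {1..C}" by auto
  then have "measure_pmf.prob F {..C} = measure_pmf.prob F {0} + measure_pmf.prob F {1..C}"
    by (simp only:) (rule measure_pmf.finite_measure_Union, auto)
  then have "measure_pmf.prob F {..C} = (\<Sum>i=1..C. zipf_pop N v i)"
    using 0 sum[OF \<open>C \<le> N\<close>] by simp
  moreover have "{C<..} = space (measure_pmf F) - {..C}" by auto
  ultimately show ?thesis
    using measure_pmf.prob_compl[of "{..C}" F] by simp
qed

theorem theorem2:
  fixes M :: "'w measure" and Y :: "nat \<Rightarrow> 'w \<Rightarrow> slot_input"
    and alpha :: "real measure" and F :: "nat pmf"
    and N :: nat and pc pu v R Ep Abar dt E0 :: real and Eu :: "real \<Rightarrow> real" and C0 :: nat
  defines "C \<equiv> C_thr_EE N v pc pu Ep R Eu"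
  defines "\<eta> \<equiv> eta_EE N v pc pu C"
  assumes "prob_space M"
    and "1 \<le> N" and "0 < pc" and "pc \<le> 1" and "0 \<le> pu" and "pu \<le> 1" and "0 < v"
    and "0 < R" and "0 < Ep"
    and "continuous_on {0..R} Eu" and "strict_mono_on {0..R} Eu" and "\<forall>d\<in>{0..R}. 0 \<le> Eu d"
    and "prob_space alpha" and "sets alpha = sets borel" and "AE a in alpha. 0 \<le> a"
    and "integrable alpha (\<lambda>a. a)" and "Abar = (\<integral>a. a \<partial>alpha)"
    and "\<forall>i\<in>{1..N}. pmf F i = zipf_pop N v i"
    and "prob_space.indep_vars M (\<lambda>_. slot_dist N pc pu F R alpha) Y UNIV"
    and "\<forall>k. distr M (slot_dist N pc pu F R alpha) (Y k) = slot_dist N pc pu F R alpha"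
    and "dt \<in> {0..R}"
    and "part_unicast R Eu dt \<le> min (Ebar_u R Eu) ((1 / \<eta>) * max 0 (Abar - pc * real C * Ep / (real N + pc)))"
    and "\<forall>d\<in>{0..R}. part_unicast R Eu d \<le> min (Ebar_u R Eu) ((1 / \<eta>) * max 0 (Abar - pc * real C * Ep / (real N + pc))) \<longrightarrow> d \<le> dt"
    and "C0 \<le> N" and "0 \<le> E0"
    and "pc * real C * Ep / (real N + pc) \<le> Abar"
  shows "AE \<omega> in M. (\<lambda>K. real (card {k. k < K \<and> eetb_blocked C Ep Eu dt (C0, E0) (\<lambda>k. Y k \<omega>) k}) / real K)
           \<longlonglongrightarrow> pc * pu * real C / (real N + pc) * (1 - (\<Sum>i=1..C. zipf_pop N v i))
               + \<eta> * ((R\<^sup>2 - dt\<^sup>2) / R\<^sup>2)"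
proof -
  note N = \<open>1 \<le> N\<close> and pc = \<open>0 < pc\<close> \<open>pc \<le> 1\<close> and R = \<open>0 < R\<close> and dt = \<open>dt \<in> {0..R}\<close>
  \<comment> \<open>\<open>Eu\<close> is arbitrary outside \<open>{0..R}\<close> and may fail to be measurable there.\<close>
  define Eu' where "Eu' d = Eu (max 0 (min R d))" for d
  have Eu'_eq: "Eu' d = Eu d" if "d \<in> {0..R}" for d
    using that by (simp add: Eu'_def)
  have C: "C \<le> N" by (simp add: C_def C_thr_EE_def)
  interpret eetb_params N C pc R Ep dt Eu'
  proof
    show "continuous_on UNIV Eu'"
      unfolding Eu'_def using R
      by (intro continuous_on_compose2[OF \<open>continuous_on {0..R} Eu\<close>]) (auto intro!: continuous_intros)
    show "strict_mono_on {0..R} Eu'"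
      using \<open>strict_mono_on {0..R} Eu\<close> by (simp add: strict_mono_on_def Eu'_eq)
  qed (use N pc C R \<open>0 < Ep\<close> dt Eu'_eq \<open>\<forall>d\<in>{0..R}. 0 \<le> Eu d\<close> in auto)
  define \<psi> where "\<psi> = pc * real C / (real N + pc)"
  define \<rho> where "\<rho> = pu * measure_pmf.prob F {C<..}"
  have \<rho>: "\<rho> = pu * (1 - (\<Sum>i=1..C. zipf_pop N v i))"
    using zipf_pmf_above[OF \<open>\<forall>i\<in>{1..N}. pmf F i = zipf_pop N v i\<close> N C] by (simp add: \<rho>_def)
  have \<eta>: "\<eta> = (1 - \<psi>) * \<rho>"
    by (simp add: \<eta>_def eta_EE_def \<psi>_def \<rho>)
  have "pc * real C \<le> 1 * real N" using pc C by (intro mult_mono) auto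
  then have \<eta>_nonneg: "0 \<le> \<eta>"
    unfolding \<eta> using pc N \<open>0 \<le> pu\<close> by (intro mult_nonneg_nonneg) (auto simp: \<psi>_def \<rho>_def)
  have part: "part_unicast R Eu' dt = part_unicast R Eu dt"
    unfolding part_unicast_def using dt by (intro integral_cong) (auto simp: Eu'_eq)
  have "\<eta> * part_unicast R Eu dt \<le> Abar - \<psi> * Ep"
  proof (cases "\<eta> = 0")
    \<comment> \<open>Since \<open>1 / 0 = 0\<close>, the bound on \<open>dt\<close> no longer
      involves \<open>Abar\<close> here. No unicast energy is needed on average, and the budget is
      just the assumed lower bound on \<open>Abar\<close>.\<close>
    case True
    then show ?thesis using \<open>pc * real C * Ep / (real N + pc) \<le> Abar\<close> by (simp add: \<psi>_def)
  next
    case False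
    then have "0 < \<eta>" using \<eta>_nonneg by simp
    moreover have "part_unicast R Eu dt \<le> (1 / \<eta>) * (Abar - \<psi> * Ep)"
      using \<open>part_unicast R Eu dt \<le> min _ _\<close> \<open>pc * real C * Ep / (real N + pc) \<le> Abar\<close> by (simp add: \<psi>_def)
    ultimately show ?thesis by (simp add: field_simps)
  qed
  then have budget: "\<psi> * Ep + (1 - \<psi>) * (\<rho> * part_unicast R Eu' dt) \<le> Abar"
    by (simp add: part \<eta> mult.assoc)
  have "AE \<omega> in M. (\<forall>k. radius (Y k \<omega>) \<le> R) \<and>
      (\<lambda>K. real (card {k. k < K \<and> eetb_blocked C Ep Eu' dt (C0, E0) (\<lambda>k. Y k \<omega>) k}) / real K)
        \<longlonglongrightarrow> \<psi> * \<rho> + (1 - \<psi>) * (\<rho> * (1 - dt\<^sup>2 / R\<^sup>2))"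
    unfolding \<psi>_def \<rho>_def
    by (rule blocking_probability) (use assms(3-) budget[unfolded \<psi>_def \<rho>_def] in blast)+
  then show ?thesis
  proof eventually_elim
    case (elim \<omega>)
    have eq: "Eu' (radius (Y k \<omega>)) = Eu (radius (Y k \<omega>))" for k
      using elim by (intro Eu'_eq) simp
    have "eetb_state C Ep Eu' dt (C0, E0) (\<lambda>k. Y k \<omega>) k = eetb_state C Ep Eu dt (C0, E0) (\<lambda>k. Y k \<omega>) k" for k
      by (rule eetb_state_cong) (simp_all add: eq Eu'_eq[OF dt])
    then have "eetb_blocked C Ep Eu' dt (C0, E0) (\<lambda>k. Y k \<omega>) k = eetb_blocked C Ep Eu dt (C0, E0) (\<lambda>k. Y k \<omega>) k" for k
      by (simp add: eetb_blocked_def eetb_unicast_def case_prod_unfold eq Eu'_eq[OF dt])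
    moreover have "\<psi> * \<rho> + (1 - \<psi>) * (\<rho> * (1 - dt\<^sup>2 / R\<^sup>2)) =
      pc * pu * real C / (real N + pc) * (1 - (\<Sum>i=1..C. zipf_pop N v i)) + \<eta> * ((R\<^sup>2 - dt\<^sup>2) / R\<^sup>2)"
      using R by (simp add: \<eta> diff_divide_distrib) (simp add: \<psi>_def \<rho>)
    ultimately show ?case using elim by simp
  qed
qed

end
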